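(* Every simple object of ${}^{H_8}_{H_8}\mathcal{YD}$ is isomorphic to exactly one of the following $22$ pairwise non-isomorphic simple Yetter–Drinfeld modules: the $8$ one-dimensional modules $M\langle b,g\rangle$ with $(b,g)\in\{(\pm1,1),(\pm1,xy),(\pm\mathrm{i},x),(\pm\mathrm{i},y)\}$, and the $14$ two-dimensional modules $M\langle(1,xy)\rangle$, $M\langle(x,y)\rangle$, $M\langle(g_1,g_2)\rangle$ for $(g_1,g_2)\in\{(1,y),(x,1),(xy,x),(y,xy)\}$, $W^{b_1,b_2}$ for $b_1,b_2\in\{\pm1\}$, and $W_1^a$, $W_2^a$ for $a\in\{-1+\sqrt2,-1-\sqrt2\}$. (In particular, each of these data defines a simple Yetter–Drinfeld module.)
   Context: $\mathbb{K}$ is an algebraically closed field of characteristic $0$, $\mathrm{i}\in\mathbb{K}$ a fixed square root of $-1$, $\sqrt2$ a fixed square root of $2$, and $\sqrt{\mathrm{i}}$ a fixed square root of $\mathrm{i}$ (e.g. $\cos\frac\pi4+\mathrm{i}\sin\frac\pi4$). $H_8$ is the Hopf algebra generated by $x,y,z$ with $x^2=y^2=1$, $z^2=\frac12(1+x+y-xy)$, $xy=yx$, $zx=yz$, $zy=xz$, $\Delta(x)=x\otimes x$, $\Delta(y)=y\otimes y$, $\Delta(z)=\frac12(1\otimes1+1\otimes x+y\otimes1-y\otimes x)(z\otimes z)$, $\varepsilon=1$ on generators, $S(x)=x,S(y)=y,S(z)=z$. Put $f_{jk}=\frac14(1+(-1)^jx)(1+(-1)^ky)$ and $w=(f_{00}+\sqrt{\mathrm{i}}f_{10}+\frac{1}{\sqrt{\mathrm{i}}}f_{01}+\mathrm{i}f_{11})z\in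 H_8$. ${}^{H_8}_{H_8}\mathcal{YD}$ is the category of left Yetter–Drinfeld modules over $H_8$ (left module and left comodule with $\rho(h\cdot m)=h_{(1)}m_{(-1)}S(h_{(3)})\otimes h_{(2)}\cdot m_{(0)}$). Modules (action and coaction on a basis): - $M\langle b,g\rangle=\mathbb{K}p$: $x\cdot p=y\cdot p=b^2p$, $z\cdot p=bp$, $\rho(p)=g\otimes p$. - $M\langle(1,xy)\rangle$, basis $p_1,p_2$: $x\cdot p_k=y\cdot p_k=-p_k$, $z\cdot p_1=\mathrm{i}p_2$, $z\cdot p_2=\mathrm{i}p_1$, $\rho(p_1)=1\otimes p_1$, $\rho(p_2)=xy\otimes p_2$. - $M\langle(x,y)\rangle$, basis $p_1,p_2$: $x\cdot p_k=y\cdot p_k=p_k$, $z\cdot p_1=p_2$, $z\cdot p_2=p_1$, $\rho(p_1)=x\otimes p_1$, $\rho(p_2)=y\otimes p_2$. - $M\langle(g_1,g_2)\rangle$, basis $p_1,p_2$: $x\cdot p_1=p_1$, $x\cdot p_2=-p_2$, $y\cdot p_1=-p_1$, $y\cdot p_2=p_2$, $z\cdot p_1=p_2$, $z\cdot p_2=p_1$, $\rho(p_k)=g_k\otimes p_k$. - $W^{b_1,b_2}$, basis $p_1,p_2$: $x\cdot p_1=y\cdot p_1=p_1$, $x\cdot p_2=y\cdot p_2=-p_2$, $z\cdot p_1=b_2p_1$, $z\cdot p_2=-\mathrm{i}b_1b_2p_2$, $\rho(p_1)=(f_{00}-\mathrm{i}b_1f_{11})z\otimes p_1+(f_{10}+\mathrm{i}b_1f_{01})z\otimes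 p_2$, $\rho(p_2)=(f_{00}+\mathrm{i}b_1f_{11})z\otimes p_2+(f_{10}-\mathrm{i}b_1f_{01})z\otimes p_1$. - $W_1^a$, basis $w_1,w_2$: $x\cdot w_1=-w_1$, $y\cdot w_1=w_1$, $z\cdot w_1=\frac12(1-\mathrm{i})(a+1)w_2$, $x\cdot w_2=w_2$, $y\cdot w_2=-w_2$, $z\cdot w_2=\frac12(1+\mathrm{i})(a+1)w_1$; $\rho(w_1)=\frac12(x+y)w\otimes w_1+\frac{\sqrt{\mathrm{i}}}{2}(x-y)w\otimes w_2$, $\rho(w_2)=\frac12(1+xy)w\otimes w_2+\frac{\sqrt{\mathrm{i}}}2(1-xy)w\otimes w_1$. - $W_2^a$, basis $w_1,w_2$: $x\cdot w_1=w_1$, $y\cdot w_1=-w_1$, $z\cdot w_1=\frac12(1-\mathrm{i})(a+1)w_2$, $x\cdot w_2=-w_2$, $y\cdot w_2=w_2$, $z\cdot w_2=\frac12(1+\mathrm{i})(a+1)w_1$; coaction given by the same formulas as for $W_1^a$. *)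

theory Defs
  imports Main "HOL-Computational_Algebra.Polynomial" "HOL-Library.Product_Plus"
begin

text \<open>Basis of H_8: the element ((a,b),c) stands for x^a y^b z^c (a,b,c booleans,
  True = exponent 1).  An element of H_8 is given by its coordinates in this basis.
  The group-like part G = {1,x,y,xy} is encoded as bool x bool.\<close>

type_synonym hidx = "(bool \<times> bool) \<times> bool"
type_synonym 'k h8 = "hidx \<Rightarrow> 'k"

definition gmul :: "bool \<times> bool \<Rightarrow> bool \<times> bool \<Rightarrow> bool \<times> bool" where
  "gmul g h = (fst g \<noteq> fst h, snd g \<noteq> snd h)"

text \<open>conjugation by z: z g = gsw g z  (swaps x and y)\<close>
definition gsw :: "bool \<times> bool \<Rightarrow> bool \<times> bool" where
  "gsw g = (snd g, fst g)"

definition ge :: "bool \<times> bool" where "ge = (False, False)"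
definition gx :: "bool \<times> bool" where "gx = (True, False)"
definition gy :: "bool \<times> bool" where "gy = (False, True)"
definition gxy :: "bool \<times> bool" where "gxy = (True, True)"

definition hbas :: "hidx \<Rightarrow> 'k::field h8" where
  "hbas i = (\<lambda>j. if j = i then 1 else 0)"

definition hplus :: "'k::field h8 \<Rightarrow> 'k h8 \<Rightarrow> 'k h8" where
  "hplus u v = (\<lambda>j. u j + v j)"

definition hscal :: "'k::field \<Rightarrow> 'k h8 \<Rightarrow> 'k h8" where
  "hscal c u = (\<lambda>j. c * u j)"

text \<open>Product of basis elements, from the defining relations:
  (g z^a)(h z^b) = g (z^a h z^-a) z^(a+b), and z^2 = 1/2 (1 + x + y - xy).\<close>
definition hbmul :: "hidx \<Rightarrow> hidx \<Rightarrow> 'k::field h8" where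
  "hbmul i j = (case (snd i, snd j) of
       (False, False) \<Rightarrow> hbas (gmul (fst i) (fst j), False)
     | (False, True) \<Rightarrow> hbas (gmul (fst i) (fst j), True)
     | (True, False) \<Rightarrow> hbas (gmul (fst i) (gsw (fst j)), True)
     | (True, True) \<Rightarrow> (let k = gmul (fst i) (gsw (fst j)) in
          hscal (1/2) (\<lambda>t. hbas (k, False) t + hbas (gmul k gx, False) t
                         + hbas (gmul k gy, False) t - hbas (gmul k gxy, False) t)))"

definition hmul :: "'k::field h8 \<Rightarrow> 'k h8 \<Rightarrow> 'k h8" where
  "hmul u v = (\<lambda>k. \<Sum>i\<in>UNIV. \<Sum>j\<in>UNIV. u i * v j * hbmul i j k)"

definition hone :: "'k::field h8" where "hone = hbas (ge, False)"
definition hx :: "'k::field h8" where "hx = hbas (gx, False)"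
definition hy :: "'k::field h8" where "hy = hbas (gy, False)"
definition hz :: "'k::field h8" where "hz = hbas (ge, True)"

text \<open>Comultiplication of a basis element, as coordinates in the basis of H_8 (x) H_8:
  Delta(g) = g (x) g,
  Delta(g z) = (g (x) g) * 1/2 (1(x)1 + 1(x)x + y(x)1 - y(x)x)(z(x)z).\<close>
definition hbas2 :: "hidx \<times> hidx \<Rightarrow> hidx \<times> hidx \<Rightarrow> 'k::field" where
  "hbas2 t s = (if s = t then 1 else 0)"

definition hcomul :: "hidx \<Rightarrow> hidx \<times> hidx \<Rightarrow> 'k::field" where
  "hcomul i = (let g = fst i in
     if \<not> snd i then hbas2 ((g, False), (g, False))
     else (\<lambda>s. (1/2) * (hbas2 ((g, True), (g, True)) s
                       + hbas2 ((g, True), (gmul g gx, True)) s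
                       + hbas2 ((gmul g gy, True), (g, True)) s
                       - hbas2 ((gmul g gy, True), (gmul g gx, True)) s)))"

definition hcomul2 :: "hidx \<Rightarrow> hidx \<times> hidx \<times> hidx \<Rightarrow> 'k::field" where
  "hcomul2 i t = (case t of (a, b, c) \<Rightarrow> \<Sum>j\<in>UNIV. hcomul i (j, c) * hcomul j (a, b))"

definition hcounit :: "hidx \<Rightarrow> 'k::field" where
  "hcounit i = 1"

text \<open>Antipode on basis elements: S(g) = g, S(g z) = S(z) S(g) = z g = gsw(g) z.\<close>
definition hantipode :: "hidx \<Rightarrow> 'k::field h8" where
  "hantipode i = (if snd i then hbas (gsw (fst i), True) else hbas (fst i, False))"

text \<open>A YD module on a type 'v: a vector space structure sc, the action act i of the
  basis element i of H_8, and the coaction given by rho m = \<Sum>i\<in>UNIV. (basis i) (x) (rho m i).\<close>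

definition is_YD :: "('k::field \<Rightarrow> 'v::ab_group_add \<Rightarrow> 'v) \<Rightarrow> (hidx \<Rightarrow> 'v \<Rightarrow> 'v)
    \<Rightarrow> ('v \<Rightarrow> hidx \<Rightarrow> 'v) \<Rightarrow> bool" where
  "is_YD sc act rho \<longleftrightarrow>
     vector_space sc \<and>
     \<comment> \<open>left H_8-module\<close>
     (\<forall>i u v. act i (u + v) = act i u + act i v) \<and>
     (\<forall>i c u. act i (sc c u) = sc c (act i u)) \<and>
     (\<forall>u. act (ge, False) u = u) \<and>
     (\<forall>i j u. act i (act j u) = (\<Sum>k\<in>UNIV. sc (hbmul i j k) (act k u))) \<and>
     \<comment> \<open>left H_8-comodule\<close>
     (\<forall>i u v. rho (u + v) i = rho u i + rho v i) \<and>
     (\<forall>i c u. rho (sc c u) i = sc c (rho u i)) \<and>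
     (\<forall>u. (\<Sum>i\<in>UNIV. sc (hcounit i) (rho u i)) = u) \<and>
     (\<forall>u j k. (\<Sum>i\<in>UNIV. sc (hcomul i (j, k)) (rho u i)) = rho (rho u j) k) \<and>
     \<comment> \<open>YD compatibility: rho(h.m) = h1 m_(-1) S(h3) (x) h2.m_0, for basis elements h\<close>
     (\<forall>i u k. rho (act i u) k =
        (\<Sum>a\<in>UNIV. \<Sum>b\<in>UNIV. \<Sum>c\<in>UNIV. \<Sum>l\<in>UNIV. sc (hcomul2 i (a, b, c)
             * hmul (hmul (hbas a) (hbas l)) (hantipode c) k) (act b (rho u l))))"

definition yd_sub :: "('k::field \<Rightarrow> 'v::ab_group_add \<Rightarrow> 'v) \<Rightarrow> (hidx \<Rightarrow> 'v \<Rightarrow> 'v)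
    \<Rightarrow> ('v \<Rightarrow> hidx \<Rightarrow> 'v) \<Rightarrow> 'v set \<Rightarrow> bool" where
  "yd_sub sc act rho W \<longleftrightarrow>
     0 \<in> W \<and> (\<forall>u\<in>W. \<forall>v\<in>W. u + v \<in> W) \<and> (\<forall>c. \<forall>u\<in>W. sc c u \<in> W) \<and>
     (\<forall>i. \<forall>u\<in>W. act i u \<in> W) \<and> (\<forall>u\<in>W. \<forall>i. rho u i \<in> W)"

definition yd_simple :: "('k::field \<Rightarrow> 'v::ab_group_add \<Rightarrow> 'v) \<Rightarrow> (hidx \<Rightarrow> 'v \<Rightarrow> 'v)
    \<Rightarrow> ('v \<Rightarrow> hidx \<Rightarrow> 'v) \<Rightarrow> bool" where
  "yd_simple sc act rho \<longleftrightarrow> is_YD sc act rho \<and> (UNIV :: 'v set) \<noteq> {0} \<and>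
     (\<forall>W. yd_sub sc act rho W \<longrightarrow> W = {0} \<or> W = UNIV)"

definition yd_iso :: "('k::field \<Rightarrow> 'v::ab_group_add \<Rightarrow> 'v) \<Rightarrow> (hidx \<Rightarrow> 'v \<Rightarrow> 'v)
    \<Rightarrow> ('v \<Rightarrow> hidx \<Rightarrow> 'v)
    \<Rightarrow> ('k \<Rightarrow> 'w::ab_group_add \<Rightarrow> 'w) \<Rightarrow> (hidx \<Rightarrow> 'w \<Rightarrow> 'w) \<Rightarrow> ('w \<Rightarrow> hidx \<Rightarrow> 'w) \<Rightarrow> bool" where
  "yd_iso sc1 act1 rho1 sc2 act2 rho2 \<longleftrightarrow>
     (\<exists>f. bij f \<and> (\<forall>u v. f (u + v) = f u + f v) \<and> (\<forall>c u. f (sc1 c u) = sc2 c (f u)) \<and>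
          (\<forall>i u. f (act1 i u) = act2 i (f u)) \<and> (\<forall>u i. f (rho1 u i) = rho2 (f u) i))"

definition gen_act :: "('v \<Rightarrow> 'v) \<Rightarrow> ('v \<Rightarrow> 'v) \<Rightarrow> ('v \<Rightarrow> 'v) \<Rightarrow> hidx \<Rightarrow> 'v \<Rightarrow> 'v" where
  "gen_act X Y Z i = (if fst (fst i) then X else id) \<circ> (if snd (fst i) then Y else id)
                      \<circ> (if snd i then Z else id)"

definition M1 :: "'k::field \<Rightarrow> bool \<times> bool \<Rightarrow> (hidx \<Rightarrow> 'k \<Rightarrow> 'k) \<times> ('k \<Rightarrow> hidx \<Rightarrow> 'k)" where
  "M1 b g = (gen_act (\<lambda>p. b^2 * p) (\<lambda>p. b^2 * p) (\<lambda>p. b * p),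
             (\<lambda>p i. hbas (g, False) i * p))"

definition sc2 :: "'k::field \<Rightarrow> 'k \<times> 'k \<Rightarrow> 'k \<times> 'k" where
  "sc2 c u = (c * fst u, c * snd u)"

definition e1 :: "'k::field \<times> 'k" where "e1 = (1, 0)"
definition e2 :: "'k::field \<times> 'k" where "e2 = (0, 1)"

definition lmap2 :: "'k::field \<times> 'k \<Rightarrow> 'k \<times> 'k \<Rightarrow> 'k \<times> 'k \<Rightarrow> 'k \<times> 'k" where
  "lmap2 v1 v2 u = sc2 (fst u) v1 + sc2 (snd u) v2"

definition co2 :: "(hidx \<Rightarrow> 'k::field \<times> 'k) \<Rightarrow> (hidx \<Rightarrow> 'k \<times> 'k) \<Rightarrow> 'k \<times> 'k \<Rightarrow> hidx \<Rightarrow> 'k \<times> 'k" where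
  "co2 r1 r2 u i = sc2 (fst u) (r1 i) + sc2 (snd u) (r2 i)"

definition tens :: "'k::field h8 \<Rightarrow> 'k \<times> 'k \<Rightarrow> hidx \<Rightarrow> 'k \<times> 'k" where
  "tens h v = (\<lambda>i. sc2 (h i) v)"

definition tplus :: "(hidx \<Rightarrow> 'k::field \<times> 'k) \<Rightarrow> (hidx \<Rightarrow> 'k \<times> 'k) \<Rightarrow> hidx \<Rightarrow> 'k \<times> 'k" where
  "tplus r s = (\<lambda>i. r i + s i)"

definition diagco :: "bool \<times> bool \<Rightarrow> bool \<times> bool \<Rightarrow> 'k::field \<times> 'k \<Rightarrow> hidx \<Rightarrow> 'k \<times> 'k" where
  "diagco g1 g2 = co2 (tens (hbas (g1, False)) e1) (tens (hbas (g2, False)) e2)"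

text \<open>M<(1,xy)>, depending on the chosen square root ii of -1\<close>
definition M1xy :: "'k::field \<Rightarrow> (hidx \<Rightarrow> 'k \<times> 'k \<Rightarrow> 'k \<times> 'k) \<times> ('k \<times> 'k \<Rightarrow> hidx \<Rightarrow> 'k \<times> 'k)" where
  "M1xy ii = (gen_act (lmap2 (- e1) (- e2)) (lmap2 (- e1) (- e2)) (lmap2 (sc2 ii e2) (sc2 ii e1)),
              diagco ge gxy)"

definition Mxy :: "(hidx \<Rightarrow> 'k::field \<times> 'k \<Rightarrow> 'k \<times> 'k) \<times> ('k \<times> 'k \<Rightarrow> hidx \<Rightarrow> 'k \<times> 'k)" where
  "Mxy = (gen_act (lmap2 e1 e2) (lmap2 e1 e2) (lmap2 e2 e1), diagco gx gy)"

definition Mg :: "bool \<times> bool \<Rightarrow> bool \<times> bool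
    \<Rightarrow> (hidx \<Rightarrow> 'k::field \<times> 'k \<Rightarrow> 'k \<times> 'k) \<times> ('k \<times> 'k \<Rightarrow> hidx \<Rightarrow> 'k \<times> 'k)" where
  "Mg g1 g2 = (gen_act (lmap2 e1 (- e2)) (lmap2 (- e1) e2) (lmap2 e2 e1), diagco g1 g2)"

definition hf :: "nat \<Rightarrow> nat \<Rightarrow> 'k::field h8" where
  "hf j k = hscal (1/4) (hmul (hplus hone (hscal ((-1)^j) hx)) (hplus hone (hscal ((-1)^k) hy)))"

definition WW :: "'k::field \<Rightarrow> 'k \<Rightarrow> 'k
    \<Rightarrow> (hidx \<Rightarrow> 'k \<times> 'k \<Rightarrow> 'k \<times> 'k) \<times> ('k \<times> 'k \<Rightarrow> hidx \<Rightarrow> 'k \<times> 'k)" where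
  "WW ii b1 b2 = (gen_act (lmap2 e1 (- e2)) (lmap2 e1 (- e2)) (lmap2 (sc2 b2 e1) (sc2 (- ii * b1 * b2) e2)),
     co2 (tplus (tens (hmul (hplus (hf 0 0) (hscal (- ii * b1) (hf 1 1))) hz) e1)
                (tens (hmul (hplus (hf 1 0) (hscal (ii * b1) (hf 0 1))) hz) e2))
         (tplus (tens (hmul (hplus (hf 0 0) (hscal (ii * b1) (hf 1 1))) hz) e2)
                (tens (hmul (hplus (hf 1 0) (hscal (- ii * b1) (hf 0 1))) hz) e1)))"

text \<open>w = (f00 + sqrt(i) f10 + 1/sqrt(i) f01 + i f11) z\<close>
definition hw :: "'k::field \<Rightarrow> 'k \<Rightarrow> 'k h8" where
  "hw ii si = hmul (hplus (hplus (hf 0 0) (hscal si (hf 1 0))) (hplus (hscal (1 / si) (hf 0 1)) (hscal ii (hf 1 1)))) hz"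

definition Wco :: "'k::field \<Rightarrow> 'k \<Rightarrow> 'k \<times> 'k \<Rightarrow> hidx \<Rightarrow> 'k \<times> 'k" where
  "Wco ii si = co2
     (tplus (tens (hmul (hscal (1/2) (hplus hx hy)) (hw ii si)) e1)
            (tens (hmul (hscal (si/2) (hplus hx (hscal (-1) hy))) (hw ii si)) e2))
     (tplus (tens (hmul (hscal (1/2) (hplus hone (hmul hx hy))) (hw ii si)) e2)
            (tens (hmul (hscal (si/2) (hplus hone (hscal (-1) (hmul hx hy)))) (hw ii si)) e1))"

definition Wz :: "'k::field \<Rightarrow> 'k \<Rightarrow> 'k \<times> 'k \<Rightarrow> 'k \<times> 'k" where
  "Wz ii a = lmap2 (sc2 ((1/2) * (1 - ii) * (a + 1)) e2) (sc2 ((1/2) * (1 + ii) * (a + 1)) e1)"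

definition W1 :: "'k::field \<Rightarrow> 'k \<Rightarrow> 'k
    \<Rightarrow> (hidx \<Rightarrow> 'k \<times> 'k \<Rightarrow> 'k \<times> 'k) \<times> ('k \<times> 'k \<Rightarrow> hidx \<Rightarrow> 'k \<times> 'k)" where
  "W1 ii si a = (gen_act (lmap2 (- e1) e2) (lmap2 e1 (- e2)) (Wz ii a), Wco ii si)"

definition W2 :: "'k::field \<Rightarrow> 'k \<Rightarrow> 'k
    \<Rightarrow> (hidx \<Rightarrow> 'k \<times> 'k \<Rightarrow> 'k \<times> 'k) \<times> ('k \<times> 'k \<Rightarrow> hidx \<Rightarrow> 'k \<times> 'k)" where
  "W2 ii si a = (gen_act (lmap2 e1 (- e2)) (lmap2 (- e1) e2) (Wz ii a), Wco ii si)"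

definition oned :: "'k::field \<Rightarrow> ((hidx \<Rightarrow> 'k \<Rightarrow> 'k) \<times> ('k \<Rightarrow> hidx \<Rightarrow> 'k)) list" where
  "oned ii = [M1 1 ge, M1 (-1) ge, M1 1 gxy, M1 (-1) gxy,
              M1 ii gx, M1 (-ii) gx, M1 ii gy, M1 (-ii) gy]"

definition twod :: "'k::field \<Rightarrow> 'k \<Rightarrow> 'k
    \<Rightarrow> ((hidx \<Rightarrow> 'k \<times> 'k \<Rightarrow> 'k \<times> 'k) \<times> ('k \<times> 'k \<Rightarrow> hidx \<Rightarrow> 'k \<times> 'k)) list" where
  "twod ii s2 si = [M1xy ii, Mxy, Mg ge gy, Mg gx ge, Mg gxy gx, Mg gy gxy,
     WW ii 1 1, WW ii 1 (-1), WW ii (-1) 1, WW ii (-1) (-1),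
     W1 ii si (-1 + s2), W1 ii si (-1 - s2), W2 ii si (-1 + s2), W2 ii si (-1 - s2)]"

lemma hsanity:
  "hmul hx hx = (hone :: 'k::field_char_0 h8)" "hmul hy hy = (hone :: 'k h8)"
  "hmul hx hy = (hmul hy hx :: 'k h8)"
  "hmul hz hx = (hmul hy hz :: 'k h8)" "hmul hz hy = (hmul hx hz :: 'k h8)"
  "hmul hz hz = (hscal (1/2) (hplus (hplus hone hx) (hplus hy (hscal (-1) (hmul hx hy)))) :: 'k h8)"
  by (auto simp: fun_eq_iff hmul_def hbmul_def hbas_def hone_def hx_def hy_def hz_def
        hscal_def hplus_def gmul_def gsw_def ge_def gx_def gy_def gxy_def UNIV_bool UNIV_Times_UNIV[symmetric])

end

(*
  Grading H_8 by the parity of z splits the coaction into a part with values in the group algebra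
  of {1,x,y,xy} and a part with values in the 2 x 2 matrix coalgebra spanned by z,xz,yz,xyz.
  Both parts are subobjects, and xy acts by an endomorphism of Yetter-Drinfeld modules, so a simple
  module is purely even or purely odd and xy acts by 1 or -1.

  In the even case a joint eigenvector v of x and y of degree g spans a submodule together with z v,
  whose degree is determined by g and the two eigenvalues; of the 16 possible data 4 are fixed
  (these give the one-dimensional modules) and 12 pair up into 6 two-dimensional ones.

  In the odd case the dual of the matrix coalgebra acts through T and J with T^2 = 1, J^2 = -1 and
  T J = - J T. If xy = 1 then z commutes with J, and a joint eigenvector v of J, x and z generates
  the span of v and T v, which is some W^{b1,b2}. If xy = -1 then T z commutes with x and J and
  (T z)^2 = i on the relevant eigenspace, and the eigenvalue of T z selects W_1^a or W_2^a.
  Schur's lemma turns the resulting nonzero morphisms into isomorphisms.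
*)

theory Submission
  imports Defs
begin

section \<open>The group part of \<open>H\<^sub>8\<close> and its structure constants\<close>

text \<open>The obstacle is the compatibility condition for \<open>z\<close>: the iterated coproduct
  has 16 terms, and each conjugation \<open>(a z) m S(c z)\<close> brings in a factor
  \<open>z^2\<close> with 4 more. It is expanded once, before any axiom on action or coaction is
  imposed, and then replaced by a short list of equations equivalent to \<open>is_YD\<close>. That
  list serves in both directions: to verify the models and to extract relations from an unknown
  module. No dimension is assumed of the unknown module. Eigenvectors are written down as
  \<open>v + P v / r\<close>, where \<open>P\<close> is linear and \<open>P (P v) = r^2 v\<close>.
  Origin of the constants: \<open>z^2 = (1 + x + y - x y)/2\<close> acts by -1 where
  \<open>x = y = -1\<close> and by 1 on the other joint eigenspaces, so \<open>ii\<close> enters as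
  an eigenvalue of \<open>z\<close>. The root \<open>si\<close> enters as an eigenvalue of
  \<open>T z\<close>, and \<open>a + 1\<close> is \<open>si (1 - ii)\<close> up to sign, whose
  square is \<open>ii (-2 ii) = 2\<close>.\<close>

lemma gmul_simps [simp]:
  "gmul ge g = g" "gmul g ge = g" "gmul g g = ge" "gmul g (gmul g h) = h"
  "gmul gx gy = gxy" "gmul gy gx = gxy" "gmul gx gxy = gy" "gmul gxy gx = gy"
  "gmul gy gxy = gx" "gmul gxy gy = gx"
  by (auto simp: gmul_def ge_def gx_def gy_def gxy_def prod_eq_iff)

lemma gmul_commute: "gmul g h = gmul h g"
  and gmul_assoc: "gmul (gmul g h) k = gmul g (gmul h k)"
  and gmul_left_commute: "gmul g (gmul h k) = gmul h (gmul g k)"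
  by (auto simp: gmul_def)

lemmas gmul_ac = gmul_commute gmul_assoc gmul_left_commute

lemma gsw_simps [simp]:
  "gsw ge = ge" "gsw gx = gy" "gsw gy = gx" "gsw gxy = gxy" "gsw (gsw g) = g"
  by (auto simp: gsw_def ge_def gx_def gy_def gxy_def)

lemma gsw_gmul: "gsw (gmul g h) = gmul (gsw g) (gsw h)"
  by (auto simp: gsw_def gmul_def)

lemma g_distinct [simp]:
  "ge \<noteq> gx" "ge \<noteq> gy" "ge \<noteq> gxy" "gx \<noteq> gy" "gx \<noteq> gxy" "gy \<noteq> gxy"
  "gx \<noteq> ge" "gy \<noteq> ge" "gxy \<noteq> ge" "gy \<noteq> gx" "gxy \<noteq> gx" "gxy \<noteq> gy"
  by (auto simp: ge_def gx_def gy_def gxy_def)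

lemma g_cases: "g = ge \<or> g = gx \<or> g = gy \<or> g = gxy"
  by (cases g) (auto simp: ge_def gx_def gy_def gxy_def)

lemma gmul_eq_iff: "gmul g h = k \<longleftrightarrow> h = gmul g k"
  by (metis gmul_simps(4))

lemma sum_g: "(\<Sum>g\<in>UNIV. f g) = f ge + f gx + f gy + f gxy"
proof -
  have "UNIV = {ge, gx, gy, gxy}" using g_cases by auto
  show ?thesis unfolding \<open>UNIV = _\<close> by (simp add: add.assoc)
qed

lemma sum_hidx:
  fixes f :: "hidx \<Rightarrow> 'a::comm_monoid_add"
  shows "(\<Sum>i\<in>UNIV. f i) = (\<Sum>g\<in>UNIV. f (g, False)) + (\<Sum>g\<in>UNIV. f (g, True))"
proof -
  have "(\<Sum>i\<in>UNIV. f i) = (\<Sum>g\<in>UNIV. \<Sum>b\<in>UNIV. f (g, b))"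
    by (simp add: sum.cartesian_product)
  then show ?thesis by (simp add: UNIV_bool sum.distrib)
qed

lemma hmul_hbas_left: "hmul (hbas i) v k = (\<Sum>j\<in>UNIV. v j * hbmul i j k)"
proof -
  have "hmul (hbas i) v k = (\<Sum>l\<in>UNIV. if l = i then \<Sum>j\<in>UNIV. v j * hbmul l j k else 0)"
    unfolding hmul_def by (intro sum.cong) (auto simp: hbas_def)
  then show ?thesis by simp
qed

lemma hmul_hbas_right: "hmul u (hbas j) k = (\<Sum>i\<in>UNIV. u i * hbmul i j k)"
proof -
  have "hmul u (hbas j) k = (\<Sum>i\<in>UNIV. \<Sum>l\<in>UNIV. if l = j then u i * hbmul i l k else 0)"
    unfolding hmul_def by (intro sum.cong) (auto simp: hbas_def)
  then show ?thesis by simp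
qed

lemma hmul_hbas: "hmul (hbas i) (hbas j) = hbmul i j"
proof
  fix k
  have "hmul (hbas i) (hbas j) k = (\<Sum>l\<in>UNIV. if l = i then hbmul l j k else 0)"
    unfolding hmul_hbas_right by (intro sum.cong) (auto simp: hbas_def)
  then show "hmul (hbas i) (hbas j) k = hbmul i j k" by simp
qed

section \<open>Expansion of the compatibility condition, without axioms on action and
  coaction\<close>

locale yd_ops = vector_space sc for sc :: "'k::field_char_0 \<Rightarrow> 'v::ab_group_add \<Rightarrow> 'v" +
  fixes act :: "hidx \<Rightarrow> 'v \<Rightarrow> 'v" and rho :: "'v \<Rightarrow> hidx \<Rightarrow> 'v"
begin

lemma sum_hbas2:
  "(\<Sum>a\<in>UNIV. \<Sum>b\<in>UNIV. sc (hbas2 (p, q) (a, b)) (F a b)) = F p q"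
proof -
  have "(\<Sum>a\<in>UNIV. \<Sum>b\<in>UNIV. sc (hbas2 (p, q) (a, b)) (F a b))
     = (\<Sum>a\<in>UNIV. \<Sum>b\<in>UNIV. if b = q then (if a = p then F a b else 0) else 0)"
    by (intro sum.cong) (auto simp: hbas2_def)
  then show ?thesis by (simp add: sum.delta)
qed

lemma sum_hcomul_F:
  "(\<Sum>a\<in>UNIV. \<Sum>b\<in>UNIV. sc (hcomul (g, False) (a, b)) (F a b)) = F (g, False) (g, False)"
  by (simp add: hcomul_def Let_def sum_hbas2)

text \<open>The Sweedler sum of \<open>F\<close> over the coproduct of \<open>g z\<close>, with
  \<open>F\<close> taken on the group parts of the two legs.\<close>

definition comul_z :: "(bool \<times> bool \<Rightarrow> bool \<times> bool \<Rightarrow> 'v) \<Rightarrow> bool \<times> bool \<Rightarrow> 'v" where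
  "comul_z F g = sc (1/2) (F g g + F g (gmul g gx) + F (gmul g gy) g - F (gmul g gy) (gmul g gx))"

lemma sum_hcomul_T:
  "(\<Sum>a\<in>UNIV. \<Sum>b\<in>UNIV. sc (hcomul (g, True) (a, b)) (F a b))
   = comul_z (\<lambda>a b. F (a, True) (b, True)) g"
proof -
  let ?H = "\<lambda>p q. \<Sum>a\<in>UNIV. \<Sum>b\<in>UNIV. sc (hbas2 (p, q) (a, b)) (F a b)"
  have "(\<Sum>a\<in>UNIV. \<Sum>b\<in>UNIV. sc (hcomul (g, True) (a, b)) (F a b))
    = sc (1/2) (?H (g,True) (g,True) + ?H (g,True) (gmul g gx,True)
        + ?H (gmul g gy,True) (g,True) - ?H (gmul g gy,True) (gmul g gx,True))"
    unfolding scale_right_distrib scale_right_diff_distrib scale_sum_right sum.distrib[symmetric] sum_subtractf[symmetric]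
    by (intro sum.cong refl) (simp add: hcomul_def algebra_simps add_divide_distrib diff_divide_distrib)
  then show ?thesis by (simp add: sum_hbas2 comul_z_def)
qed

text \<open>\<open>hcomul2\<close> is the coproduct applied to the left leg of a coproduct, so
  reordering finite sums yields two nested Sweedler sums.\<close>

lemma sum_hcomul2:
  "(\<Sum>a\<in>UNIV. \<Sum>b\<in>UNIV. \<Sum>c\<in>UNIV. sc (hcomul2 i (a, b, c)) (F a b c))
   = (\<Sum>j\<in>UNIV. \<Sum>c\<in>UNIV. sc (hcomul i (j, c)) (\<Sum>a\<in>UNIV. \<Sum>b\<in>UNIV. sc (hcomul j (a, b)) (F a b c)))"
proof -
  have "(\<Sum>a\<in>UNIV. \<Sum>b\<in>UNIV. \<Sum>c\<in>UNIV. sc (hcomul2 i (a, b, c)) (F a b c))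
    = (\<Sum>a\<in>UNIV. \<Sum>b\<in>UNIV. \<Sum>c\<in>UNIV. \<Sum>j\<in>UNIV. sc (hcomul i (j, c)) (sc (hcomul j (a, b)) (F a b c)))"
    by (simp add: hcomul2_def scale_sum_left)
  also have "\<dots> = (\<Sum>a\<in>UNIV. \<Sum>b\<in>UNIV. \<Sum>j\<in>UNIV. \<Sum>c\<in>UNIV. sc (hcomul i (j, c)) (sc (hcomul j (a, b)) (F a b c)))"
    by (intro sum.cong refl sum.swap)
  also have "\<dots> = (\<Sum>a\<in>UNIV. \<Sum>j\<in>UNIV. \<Sum>b\<in>UNIV. \<Sum>c\<in>UNIV. sc (hcomul i (j, c)) (sc (hcomul j (a, b)) (F a b c)))"
    by (intro sum.cong refl sum.swap)
  also have "\<dots> = (\<Sum>j\<in>UNIV. \<Sum>a\<in>UNIV. \<Sum>b\<in>UNIV. \<Sum>c\<in>UNIV. sc (hcomul i (j, c)) (sc (hcomul j (a, b)) (F a b c)))"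
    by (rule sum.swap)
  also have "\<dots> = (\<Sum>j\<in>UNIV. \<Sum>a\<in>UNIV. \<Sum>c\<in>UNIV. \<Sum>b\<in>UNIV. sc (hcomul i (j, c)) (sc (hcomul j (a, b)) (F a b c)))"
    by (intro sum.cong refl sum.swap)
  also have "\<dots> = (\<Sum>j\<in>UNIV. \<Sum>c\<in>UNIV. \<Sum>a\<in>UNIV. \<Sum>b\<in>UNIV. sc (hcomul i (j, c)) (sc (hcomul j (a, b)) (F a b c)))"
    by (intro sum.cong refl sum.swap)
  finally show ?thesis by (simp only: scale_sum_right)
qed


text \<open>The coordinate at \<open>k\<close> of \<open>a u_(-1) S(c) \<otimes> b u_(0)\<close>.
  The middle leg \<open>b\<close> is the first argument.\<close>

definition hcomul_conj where
  "hcomul_conj b a c k u = (\<Sum>l\<in>UNIV. sc (hmul (hmul (hbas a) (hbas l)) (hantipode c) k) (act b (rho u l)))"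

definition compat_rhs where
  "compat_rhs i u k = (\<Sum>a\<in>UNIV. \<Sum>b\<in>UNIV. \<Sum>c\<in>UNIV. \<Sum>l\<in>UNIV. sc (hcomul2 i (a, b, c)
             * hmul (hmul (hbas a) (hbas l)) (hantipode c) k) (act b (rho u l)))"

lemma compat_rhs_eq:
  "compat_rhs i u k = (\<Sum>j\<in>UNIV. \<Sum>c\<in>UNIV. sc (hcomul i (j, c))
     (\<Sum>a\<in>UNIV. \<Sum>b\<in>UNIV. sc (hcomul j (a, b)) (hcomul_conj b a c k u)))"
  unfolding compat_rhs_def hcomul_conj_def sum_hcomul2[symmetric]
  by (simp add: scale_sum_right)

lemma compat_rhs_F: "compat_rhs (g, False) u k = hcomul_conj (g, False) (g, False) (g, False) k u"
  by (simp add: compat_rhs_eq sum_hcomul_F)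

lemma compat_rhs_T: "compat_rhs (g, True) u k =
   comul_z (\<lambda>j c. comul_z (\<lambda>a b. hcomul_conj (b, True) (a, True) (c, True) k u) j) g"
  by (simp add: compat_rhs_eq sum_hcomul_T)

lemma sum_delta_sc: "(\<Sum>m\<in>UNIV. sc (if (k :: bool \<times> bool) = m then c else 0) (f m)) = sc c (f k)"
proof -
  have "(\<Sum>m\<in>UNIV. sc (if k = m then c else 0) (f m)) = (\<Sum>m\<in>UNIV. if k = m then sc c (f m) else 0)"
    by (intro sum.cong) auto
  then show ?thesis by simp
qed

text \<open>The group is commutative of exponent 2, so conjugation by \<open>g\<close> fixes even
  coordinates. On odd ones, \<open>z g = (gsw g) z\<close> produces the shift by
  \<open>g (gsw g)\<close>.\<close>

lemma hcomul_conj_F: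
  "hcomul_conj b (g, False) (g, False) (k, False) u = act b (rho u (k, False))"
  "hcomul_conj b (g, False) (g, False) (k, True) u = act b (rho u (gmul k (gmul g (gsw g)), True))"
proof -
  have 1: "hmul (hmul (hbas (g, False)) (hbas (m, False))) (hantipode (g, False)) = hbas (m, False)" for m
    by (simp add: hmul_hbas hbmul_def hantipode_def gmul_ac)
  have 2: "hmul (hmul (hbas (g, False)) (hbas (m, True))) (hantipode (g, False)) = hbas (gmul m (gmul g (gsw g)), True)" for m
    by (simp add: hmul_hbas hbmul_def hantipode_def gmul_ac)
  show "hcomul_conj b (g, False) (g, False) (k, False) u = act b (rho u (k, False))"
    unfolding hcomul_conj_def sum_hidx 1 2 by (simp add: hbas_def sum_delta_sc)
  have 3: "k = gmul m (gmul g (gsw g)) \<longleftrightarrow> gmul k (gmul g (gsw g)) = m" for m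
    by (metis gmul_commute gmul_eq_iff)
  show "hcomul_conj b (g, False) (g, False) (k, True) u = act b (rho u (gmul k (gmul g (gsw g)), True))"
    unfolding hcomul_conj_def sum_hidx 1 2 by (simp add: hbas_def 3 sum_delta_sc)
qed

text \<open>With \<open>F n = act (n, False) u\<close> this is the action of \<open>k z^2\<close>.
  The same combination reads off the coordinate at \<open>k\<close> of a product with
  \<open>z^2\<close>, since each group element is its own inverse.\<close>

definition zsq :: "(bool \<times> bool \<Rightarrow> 'v) \<Rightarrow> bool \<times> bool \<Rightarrow> 'v" where
  "zsq F k = sc (1/2) (F k + F (gmul k gx) + F (gmul k gy) - F (gmul k gxy))"

text \<open>As \<open>S(c z) = (gsw c) z\<close>, an even \<open>m\<close> is sent to
  \<open>a c (gsw m) z^2\<close> and an odd \<open>m z\<close> to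
  \<open>a (gsw m) (gsw c) z^2 z\<close>. The arguments \<open>gsw (...)\<close> solve these for
  \<open>m\<close>.\<close>

lemma hcomul_conj_T:
  "hcomul_conj b (a, True) (c, True) (k, False) u
    = zsq (\<lambda>n. act b (rho u (gsw (gmul n (gmul a c)), False))) k"
  "hcomul_conj b (a, True) (c, True) (k, True) u
    = zsq (\<lambda>n. act b (rho u (gsw (gmul n (gmul a (gsw c))), True))) k"
proof -
  have zz: "(hbmul (p, True) (q, True) :: 'k h8) (k, False) =
     (1/2) * ((if k = gmul p (gsw q) then 1 else 0) + (if gmul k gx = gmul p (gsw q) then 1 else 0)
     + (if gmul k gy = gmul p (gsw q) then 1 else 0) - (if gmul k gxy = gmul p (gsw q) then 1 else 0))"
     "(hbmul (p, True) (q, True) :: 'k h8) (k, True) = 0" for p q k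
    by (auto simp: hbmul_def Let_def hscal_def hbas_def intro!: arg_cong2[of _ _ _ _ "(+)"] arg_cong2[of _ _ _ _ "(-)"])
       (metis gmul_commute gmul_eq_iff)+
  have zf: "(hbmul (p, True) (q, False) :: 'k h8) = hbas (gmul p (gsw q), True)" for p q
    by (simp add: hbmul_def)
  have zg: "(hbmul (p, False) (q, True) :: 'k h8) = hbas (gmul p q, True)" for p q
    by (simp add: hbmul_def)
  have swap: "k = gmul a (gmul c (gsw m)) \<longleftrightarrow> gsw (gmul k (gmul a c)) = m" for k m a c
    by (smt (verit) gmul_commute gmul_left_commute gmul_simps(4) gsw_simps(5))
  have FF: "hmul (hmul (hbas (a, True)) (hbas (m, False))) (hantipode (c, True)) = (hbmul (gmul a (gsw m), True) (gsw c, True) :: 'k h8)" for m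
    by (simp add: hmul_hbas zf hantipode_def)
  have TT: "hmul (hmul (hbas (a, True)) (hbas (m, True))) (hantipode (c, True)) (k, t)
      = (if t then hbmul (a, True) (m, True) (gmul k (gsw c), False) else (0::'k))" for m t
  proof -
    have "hmul (hmul (hbas (a, True)) (hbas (m, True))) (hantipode (c, True)) (k, t)
       = (\<Sum>g\<in>UNIV. hbmul (a, True) (m, True) (g, False) * (hbas (gmul g (gsw c), True) (k, t) :: 'k))"
      by (simp add: hmul_hbas_right hmul_hbas hantipode_def sum_hidx zz zg)
    also have "\<dots> = (\<Sum>g\<in>UNIV. if g = gmul k (gsw c) then (if t then hbmul (a, True) (m, True) (g, False) else 0) else 0)"
      by (intro sum.cong refl) (auto simp: hbas_def gmul_ac)
    finally show ?thesis by simp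
  qed
  have swap': "gmul (gmul k (gsw c)) n = gmul a (gsw m) \<longleftrightarrow> gsw (gmul (gmul k n) (gmul a (gsw c))) = m" for k n m
    by (auto simp: gmul_def gsw_def prod_eq_iff)
  show "hcomul_conj b (a, True) (c, True) (k, False) u
    = zsq (\<lambda>n. act b (rho u (gsw (gmul n (gmul a c)), False))) k"
    unfolding hcomul_conj_def sum_hidx FF TT
    by (simp add: zz gmul_assoc gmul_commute[of "gsw m" c for m] swap zsq_def scale_right_distrib
        scale_right_diff_distrib scale_left_distrib scale_left_diff_distrib sum.distrib sum_subtractf add_divide_distrib
        diff_divide_distrib if_distrib[of "\<lambda>x. x / 2"] sum_delta_sc cong: if_cong)
  show "hcomul_conj b (a, True) (c, True) (k, True) u
    = zsq (\<lambda>n. act b (rho u (gsw (gmul n (gmul a (gsw c))), True))) k"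
    unfolding hcomul_conj_def sum_hidx FF TT
    by (simp add: zz swap' swap'[where n = ge, simplified] zsq_def scale_right_distrib
        scale_right_diff_distrib scale_left_distrib scale_left_diff_distrib sum.distrib sum_subtractf add_divide_distrib
        diff_divide_distrib if_distrib[of "\<lambda>x. x / 2"] sum_delta_sc cong: if_cong)
qed

end

declare split_paired_All [simp del] split_paired_Ex [simp del]

context yd_ops begin

text \<open>The coordinates of \<open>\<rho>(z u)\<close> predicted by the Yetter-Drinfeld condition. The 64 terms
  that \<open>\<Delta>\<^sup>2(z)\<close> produces per coordinate collapse to these.\<close>

definition zco_F :: "bool \<times> bool \<Rightarrow> 'v \<Rightarrow> 'v" where
  "zco_F k u = (let A = (\<lambda>q n. act (q, True) (rho u (gmul (gsw k) n, False))) in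
     sc (1/4) ((A ge ge + A gx ge + A gy ge + A gxy ge) + (A ge gy + A gx gy - A gy gy - A gxy gy)
       + (A ge gx - A gx gx + A gy gx - A gxy gx) + (A ge gxy - A gx gxy - A gy gxy + A gxy gxy)))"

definition zco_T :: "bool \<times> bool \<Rightarrow> 'v \<Rightarrow> 'v" where
  "zco_T k u = (let A = (\<lambda>q n. act (q, True) (rho u (gmul (gsw k) n, True))) in
     sc (1/2) (A ge ge + A ge gx - A gxy gy + A gxy gxy))"

text \<open>Two coproducts and one \<open>z^2\<close> contribute a factor 1/2 each. Over the common
  denominator 8 the identities below compare signed sums free of scalars.\<close>

lemma eighths: "sc (1/4) v = sc (1/8) (v + v)" "sc (1/2) v = sc (1/8) ((v + v) + (v + v))"
proof -
  have "sc (1/8) (v + v) = sc (1/8 + 1/8) v" for v by (simp only: scale_left_distrib scale_right_distrib)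
  then have *: "sc (1/8) (v + v) = sc (1/4) v" for v by simp
  then show "sc (1/4) v = sc (1/8) (v + v)" by simp
  have "sc (1/4) (v + v) = sc (1/4 + 1/4) v" for v by (simp only: scale_left_distrib scale_right_distrib)
  then have "sc (1/4) (v + v) = sc (1/2) v" for v by simp
  moreover have "sc (1/8) ((v + v) + (v + v)) = sc (1/4) (v + v)" by (rule *)
  ultimately show "sc (1/2) v = sc (1/8) ((v + v) + (v + v))" by simp
qed

lemma compat_rhs_z:
  "compat_rhs (ge, True) u (k, False) = zco_F k u"
  "compat_rhs (ge, True) u (k, True) = zco_T k u"
proof -
  show "compat_rhs (ge, True) u (k, False) = zco_F k u"
    unfolding compat_rhs_T zco_F_def comul_z_def hcomul_conj_T zsq_def Let_def eighths(1)
      scale_right_distrib[symmetric] scale_right_diff_distrib[symmetric] scale_scale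
    by (simp add: gmul_assoc gsw_gmul)
  show "compat_rhs (ge, True) u (k, True) = zco_T k u"
    unfolding compat_rhs_T zco_T_def comul_z_def hcomul_conj_T zsq_def Let_def
      scale_right_distrib[symmetric] scale_right_diff_distrib[symmetric] scale_scale
    apply (simp add: gmul_assoc gsw_gmul)
    apply (subst eighths(2))
    by (simp add: algebra_simps)
qed


text \<open>The coproduct of \<open>g j z\<close> is \<open>g \<otimes> g\<close> times that of
  \<open>j z\<close>, so a group element passes through the Sweedler sum.\<close>

lemma comul_z_gmul:
  assumes "\<And>u v. h (u + v) = h u + h v" "\<And>c u. h (sc c u) = sc c (h u)"
    "\<And>a b. F (gmul g a) (gmul g b) = h (F' a b)"
  shows "comul_z F (gmul g j) = h (comul_z F' j)"
proof -
  have m: "h (u - v) = h u - h v" for u v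
    using assms(1)[of "u - v" v] by (simp add: algebra_simps)
  show ?thesis
    by (simp add: comul_z_def assms(1,2) m gmul_assoc flip: assms(3))
qed

lemma zsq_gmul:
  assumes "\<And>u v. h (u + v) = h u + h v" "\<And>c u. h (sc c u) = sc c (h u)"
    "\<And>n. F n = h (F' (gmul n g))"
  shows "zsq F k = h (zsq F' (gmul k g))"
proof -
  have m: "h (u - v) = h u - h v" for u v
    using assms(1)[of "u - v" v] by (simp add: algebra_simps)
  show ?thesis by (simp add: zsq_def assms m gmul_ac)
qed

end

text \<open>In the presence of the other axioms the Yetter-Drinfeld condition need only be imposed
  for group elements and for \<open>z\<close>.\<close>

locale yd_reduced = yd_ops sc act rho
  for sc :: "'k::field_char_0 \<Rightarrow> 'v::ab_group_add \<Rightarrow> 'v" and act and rho +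
  assumes act_add: "act i (u + v) = act i u + act i v"
    and act_sc: "act i (sc c u) = sc c (act i u)"
    and act_one: "act (ge, False) u = u"
    and act_F: "act (g, False) (act (h, b) u) = act (gmul g h, b) u"
    and act_TF: "act (g, True) (act (h, False) u) = act (gmul g (gsw h), True) u"
    and act_TT: "act (g, True) (act (h, True) u) = zsq (\<lambda>n. act (n, False) u) (gmul g (gsw h))"
    and rho_add: "rho (u + v) i = rho u i + rho v i"
    and rho_sc: "rho (sc c u) i = sc c (rho u i)"
    and rho_counit: "(\<Sum>g\<in>UNIV. rho u (g, False)) + (\<Sum>g\<in>UNIV. rho u (g, True)) = u"
    and rho_FF: "rho (rho u (j, False)) (k, False) = (if j = k then rho u (j, False) else 0)"
    and rho_FT: "rho (rho u (j, False)) (k, True) = 0"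
    and rho_TF: "rho (rho u (j, True)) (k, False) = 0"
    and rho_TT: "rho (rho u (j, True)) (j, True) = sc (1/2) (rho u (j, True))"
      "rho (rho u (j, True)) (gmul j gx, True) = sc (1/2) (rho u (j, True))"
      "rho (rho u (j, True)) (gmul j gy, True) = sc (1/2) (rho u (gmul j gy, True))"
      "rho (rho u (j, True)) (gmul j gxy, True) = - sc (1/2) (rho u (gmul j gy, True))"
    and rho_act_F: "rho (act (g, False) u) (k, False) = act (g, False) (rho u (k, False))"
    and rho_act_T: "rho (act (g, False) u) (k, True) = act (g, False) (rho u (gmul k (gmul g (gsw g)), True))"
    and rho_z_F: "rho (act (ge, True) u) (k, False) = zco_F k u"
    and rho_z_T: "rho (act (ge, True) u) (k, True) = zco_T k u"
begin

text \<open>The right-hand side for \<open>g z\<close> arises from the one for \<open>z\<close> just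
  as \<open>rho_act_F\<close> and \<open>rho_act_T\<close> transform the left-hand side. Hence
  compatibility for group elements and \<open>z\<close> gives it for all basis elements.\<close>

lemma compat_rhs_gz:
  "compat_rhs (g, True) u (k, False) = act (g, False) (compat_rhs (ge, True) u (k, False))"
  "compat_rhs (g, True) u (k, True) = act (g, False) (compat_rhs (ge, True) u (gmul k (gmul g (gsw g)), True))"
proof -
  have F: "hcomul_conj (gmul g b, True) (gmul g a, True) (gmul g c, True) (k, False) u
    = act (g, False) (hcomul_conj (b, True) (a, True) (c, True) (k, False) u)" for a b c
    unfolding hcomul_conj_T
    by (subst (2) gmul_simps(2)[symmetric, of k], rule zsq_gmul[OF act_add act_sc]) (simp add: act_F gmul_ac)
  have T: "hcomul_conj (gmul g b, True) (gmul g a, True) (gmul g c, True) (k, True) u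
    = act (g, False) (hcomul_conj (b, True) (a, True) (c, True) (gmul k (gmul g (gsw g)), True) u)" for a b c
    unfolding hcomul_conj_T
    by (rule zsq_gmul[OF act_add act_sc]) (simp add: act_F gmul_ac gsw_gmul)
  have *: "comul_z F g = comul_z F (gmul g ge)" for F by simp
  show "compat_rhs (g, True) u (k, False) = act (g, False) (compat_rhs (ge, True) u (k, False))"
    unfolding compat_rhs_T
    by (subst *, intro comul_z_gmul[OF act_add act_sc] F)
  show "compat_rhs (g, True) u (k, True) = act (g, False) (compat_rhs (ge, True) u (gmul k (gmul g (gsw g)), True))"
    unfolding compat_rhs_T
    by (subst *, intro comul_z_gmul[OF act_add act_sc] T)
qed

lemma is_YD: "is_YD sc act rho"
proof -
  have mod: "act i (act j u) = (\<Sum>k\<in>UNIV. sc (hbmul i j k) (act k u))" for i j u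
  proof -
    have delta: "(\<Sum>m\<in>UNIV. sc (if m = k then c else 0) (f m)) = sc c (f k)" for k :: "bool \<times> bool" and c f
      using sum_delta_sc[of k c f] by (simp add: eq_commute)
    obtain g a h b where [simp]: "i = (g, a)" "j = (h, b)" by fastforce
    show ?thesis
    proof (cases a)
      case False
      then show ?thesis by (cases b) (simp_all add: act_F hbmul_def sum_hidx hbas_def delta)
    next
      case a: True
      show ?thesis
      proof (cases b)
        case False
        with a show ?thesis by (simp add: act_TF hbmul_def sum_hidx hbas_def delta)
      next
        case True
        with a show ?thesis
          by (simp add: act_TT sum_hidx hbmul_def Let_def hscal_def hbas_def delta zsq_def
              sum.distrib sum_subtractf scale_left_distrib scale_left_diff_distrib scale_right_distrib scale_right_diff_distrib
              add_divide_distrib diff_divide_distrib if_distrib[of "\<lambda>x. x / 2"] cong: if_cong)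
      qed
    qed
  qed
  have comod: "(\<Sum>i\<in>UNIV. sc (hcomul i (j, k)) (rho u i)) = rho (rho u j) k" for u j k
  proof -
    \<comment> \<open>The second index is written relative to the first, because the four equations
      \<open>rho_TT\<close> are sorted by the quotient of the two group parts.\<close>
    obtain g a h b where jk: "j = (g, a)" "k = (gmul g h, b)"
      by (metis gmul_simps(4) surj_pair)
    show ?thesis
      unfolding jk using g_cases[of g] g_cases[of h] rho_TT[of u g]
      by (cases a; cases b)
        (elim disjE; simp add: sum_hidx sum_g hcomul_def hbas2_def rho_FF rho_FT rho_TF)+
  qed
  have compat: "rho (act i u) k = compat_rhs i u k" for i u k
  proof -
    obtain g a h b where [simp]: "i = (g, a)" "k = (h, b)" by fastforce
    have gz: "act (g, True) u = act (g, False) (act (ge, True) u)" by (simp add: act_F)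
    show ?thesis
      by (cases a; cases b)
        (simp_all add: compat_rhs_F compat_rhs_gz[of g] compat_rhs_z hcomul_conj_F rho_act_F rho_act_T
          gz rho_z_F rho_z_T del: split_paired_All)
  qed
  show ?thesis
    unfolding is_YD_def compat_rhs_def[symmetric]
    by (intro conjI allI mod comod compat vector_space_axioms act_add act_sc act_one rho_add rho_sc)
      (simp add: hcounit_def sum_hidx rho_counit)
qed

end

text \<open>Converse of \<open>is_YD\<close> above: the locale axioms are equivalent to the
  definition, so the classification may start from them.\<close>

lemma (in yd_ops) yd_reduced:
  assumes "is_YD sc act rho"
  shows "yd_reduced sc act rho"
proof -
  have add: "act i (u + v) = act i u + act i v" and sca: "act i (sc c u) = sc c (act i u)"
    and one: "act (ge, False) u = u" and mult: "act i (act j u) = (\<Sum>k\<in>UNIV. sc (hbmul i j k) (act k u))"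
    and radd: "rho (u + v) i = rho u i + rho v i" and rsc: "rho (sc c u) i = sc c (rho u i)"
    and cou: "(\<Sum>i\<in>UNIV. sc (hcounit i) (rho u i)) = u"
    and com: "rho (rho u i) j = (\<Sum>k\<in>UNIV. sc (hcomul k (i, j)) (rho u k))"
    and yd: "rho (act i u) j = compat_rhs i u j" for i j u v c
    using assms unfolding is_YD_def compat_rhs_def by simp_all
  have delta: "(\<Sum>m\<in>UNIV. sc (if m = k then c else 0) (f m)) = sc c (f k)" for k :: "bool \<times> bool" and c f
    using sum_delta_sc[of k c f] by (simp add: eq_commute)
  have F: "act (g, False) (act (h, b) u) = act (gmul g h, b) u" for g h b u
    by (cases b) (simp_all add: mult hbmul_def sum_hidx hbas_def delta)
  have gz: "act (g, True) u = act (g, False) (act (ge, True) u)" for g u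
    by (simp add: F)
  show ?thesis
  proof
    fix u g k h b c v i j
    show "act (g, True) (act (h, False) u) = act (gmul g (gsw h), True) u"
      by (simp add: mult hbmul_def sum_hidx hbas_def delta)
    show "act (g, True) (act (h, True) u) = zsq (\<lambda>n. act (n, False) u) (gmul g (gsw h))"
      by (simp add: mult sum_hidx hbmul_def Let_def hscal_def hbas_def delta zsq_def
          sum.distrib sum_subtractf scale_left_distrib scale_left_diff_distrib scale_right_distrib scale_right_diff_distrib
          add_divide_distrib diff_divide_distrib if_distrib[of "\<lambda>x. x / 2"] cong: if_cong)
    show "rho (rho u (j, False)) (k, False) = (if j = k then rho u (j, False) else 0)"
      "rho (rho u (j, False)) (k, True) = 0" "rho (rho u (j, True)) (k, False) = 0"
      using g_cases[of j] g_cases[of k]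
      by (elim disjE; simp add: com sum_hidx sum_g hcomul_def hbas2_def)+
    show "rho (rho u (j, True)) (j, True) = sc (1/2) (rho u (j, True))"
      "rho (rho u (j, True)) (gmul j gx, True) = sc (1/2) (rho u (j, True))"
      "rho (rho u (j, True)) (gmul j gy, True) = sc (1/2) (rho u (gmul j gy, True))"
      "rho (rho u (j, True)) (gmul j gxy, True) = - sc (1/2) (rho u (gmul j gy, True))"
      using g_cases[of j]
      by (elim disjE; simp add: com sum_hidx sum_g hcomul_def hbas2_def)+
    show "(\<Sum>g\<in>UNIV. rho u (g, False)) + (\<Sum>g\<in>UNIV. rho u (g, True)) = u"
      using cou[of u] by (simp add: hcounit_def sum_hidx)
  qed (simp_all add: add sca one F radd rsc yd compat_rhs_F hcomul_conj_F compat_rhs_z)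
qed

section \<open>Yetter-Drinfeld modules from generators and relations\<close>

text \<open>The remaining basis elements are composites of \<open>X\<close>, \<open>Y\<close>,
  \<open>Z\<close>. Both \<open>x\<close> and \<open>y\<close> shift odd coordinates by the same
  element \<open>x (gsw x) = y (gsw y) = x y\<close>.\<close>

lemma (in yd_ops) yd_reducedI:
  assumes act: "act = gen_act X Y Z"
    and X: "\<And>u v. X (u + v) = X u + X v" "\<And>c u. X (sc c u) = sc c (X u)"
    and Y: "\<And>u v. Y (u + v) = Y u + Y v" "\<And>c u. Y (sc c u) = sc c (Y u)"
    and Z: "\<And>u v. Z (u + v) = Z u + Z v" "\<And>c u. Z (sc c u) = sc c (Z u)"
    and XX: "\<And>u. X (X u) = u" and YY: "\<And>u. Y (Y u) = u" and YX: "\<And>u. Y (X u) = X (Y u)"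
    and ZX: "\<And>u. Z (X u) = Y (Z u)" and ZY: "\<And>u. Z (Y u) = X (Z u)"
    and ZZ: "\<And>u. Z (Z u) = sc (1/2) (u + X u + Y u - X (Y u))"
    and rho_add: "\<And>u v i. rho (u + v) i = rho u i + rho v i"
    and rho_sc: "\<And>c u i. rho (sc c u) i = sc c (rho u i)"
    and rho_counit: "\<And>u. (\<Sum>g\<in>UNIV. rho u (g, False)) + (\<Sum>g\<in>UNIV. rho u (g, True)) = u"
    and rho_FF: "\<And>u j k. rho (rho u (j, False)) (k, False) = (if j = k then rho u (j, False) else 0)"
    and rho_FT: "\<And>u j k. rho (rho u (j, False)) (k, True) = 0"
    and rho_TF: "\<And>u j k. rho (rho u (j, True)) (k, False) = 0"
    and rho_TT: "\<And>u j. rho (rho u (j, True)) (j, True) = sc (1/2) (rho u (j, True))"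
      "\<And>u j. rho (rho u (j, True)) (gmul j gx, True) = sc (1/2) (rho u (j, True))"
      "\<And>u j. rho (rho u (j, True)) (gmul j gy, True) = sc (1/2) (rho u (gmul j gy, True))"
      "\<And>u j. rho (rho u (j, True)) (gmul j gxy, True) = - sc (1/2) (rho u (gmul j gy, True))"
    and rho_X: "\<And>u k. rho (X u) (k, False) = X (rho u (k, False))"
      "\<And>u k. rho (X u) (k, True) = X (rho u (gmul k gxy, True))"
    and rho_Y: "\<And>u k. rho (Y u) (k, False) = Y (rho u (k, False))"
      "\<And>u k. rho (Y u) (k, True) = Y (rho u (gmul k gxy, True))"
    and rho_Z: "\<And>u k. rho (Z u) (k, False) = zco_F k u"
      "\<And>u k. rho (Z u) (k, True) = zco_T k u"
  shows "yd_reduced sc act rho"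
proof -
  have g: "act (ge, False) u = u" "act (gx, False) u = X u" "act (gy, False) u = Y u" "act (gxy, False) u = X (Y u)"
     "act (ge, True) u = Z u" "act (gx, True) u = X (Z u)" "act (gy, True) u = Y (Z u)" "act (gxy, True) u = X (Y (Z u))" for u
    by (simp_all add: act gen_act_def ge_def gx_def gy_def gxy_def)
  show ?thesis
  proof
    fix i u v c g h b k
    show "act i (u + v) = act i u + act i v" "act i (sc c u) = sc c (act i u)"
      by (simp_all add: act gen_act_def X Y Z)
    show "act (g, False) (act (h, b) u) = act (gmul g h, b) u"
      using g_cases[of g] g_cases[of h]
      by (cases b) (elim disjE; simp add: g XX YY YX)+
    show "act (g, True) (act (h, False) u) = act (gmul g (gsw h), True) u"
      using g_cases[of g] g_cases[of h]
      by (elim disjE; simp add: g XX YY YX ZX ZY)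
    have m: "X (u - v) = X u - X v" "Y (u - v) = Y u - Y v" "Z (u - v) = Z u - Z v" for u v
      using X(1)[of "u - v" v] Y(1)[of "u - v" v] Z(1)[of "u - v" v] by (simp_all add: algebra_simps)
    show "act (g, True) (act (h, True) u) = zsq (\<lambda>n. act (n, False) u) (gmul g (gsw h))"
      using g_cases[of g] g_cases[of h]
      by (elim disjE; simp add: g XX YY YX ZX ZY ZZ X Y m zsq_def)
    show "rho (act (g, False) u) (k, False) = act (g, False) (rho u (k, False))"
      using g_cases[of g] by (elim disjE; simp add: g rho_X rho_Y)
    show "rho (act (g, False) u) (k, True) = act (g, False) (rho u (gmul k (gmul g (gsw g)), True))"
      using g_cases[of g] by (elim disjE; simp add: g rho_X rho_Y gmul_assoc)
  qed (simp_all add: g rho_add rho_sc rho_counit rho_FF rho_FT rho_TF rho_TT rho_Z)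
qed

lemma vector_space_mult: "vector_space ((*) :: 'k::field \<Rightarrow> 'k \<Rightarrow> 'k)"
  by unfold_locales (simp_all add: algebra_simps)

lemma vector_space_sc2: "vector_space (sc2 :: 'k::field \<Rightarrow> 'k \<times> 'k \<Rightarrow> 'k \<times> 'k)"
  by unfold_locales (simp_all add: sc2_def algebra_simps)

text \<open>The admissible pairs are those for which \<open>z p\<close> keeps the degree
  \<open>g\<close> of \<open>p\<close>: the degree of \<open>z p\<close> is \<open>gsw g\<close>,
  multiplied by \<open>x y\<close> when \<open>x\<close> and \<open>y\<close> act by -1.\<close>

lemma is_YD_M1:
  fixes b :: "'k::field_char_0"
  assumes "b * b = 1 \<and> g \<in> {ge, gxy} \<or> b * b = -1 \<and> g \<in> {gx, gy}"
  shows "is_YD (*) (fst (M1 b g)) (snd (M1 b g))"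
proof -
  interpret yd_ops "(*)" "fst (M1 b g)" "snd (M1 b g)"
    by (intro yd_ops.intro vector_space_mult)
  have c: "b * b = 1 \<and> g = ge \<or> b * b = 1 \<and> g = gxy \<or> b * b = -1 \<and> g = gx \<or> b * b = -1 \<and> g = gy"
    using assms by blast
  have r: "snd (M1 b g) u (k, t) = (if k = g \<and> \<not> t then u else 0)" for u k t
    by (simp add: M1_def hbas_def)
  define s where "s = b * b"
  have a: "fst (M1 b g) (ge, True) u = b * u" "fst (M1 b g) (gx, True) u = s * (b * u)"
     "fst (M1 b g) (gy, True) u = s * (b * u)"  "fst (M1 b g) (gxy, True) u = s * (s * (b * u))" for u
    by (simp_all add: M1_def gen_act_def ge_def gx_def gy_def gxy_def power2_eq_square s_def)
  have ss: "b * b * (b * b * u) = u" for u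
    using c by (auto simp flip: mult.assoc)
  interpret yd_reduced "(*)" "fst (M1 b g)" "snd (M1 b g)"
  proof (rule yd_reducedI[where X = "(*) (b * b)" and Y = "(*) (b * b)" and Z = "(*) b"])
    show "fst (M1 b g) = gen_act ((*) (b * b)) ((*) (b * b)) ((*) b)"
      by (simp add: M1_def power2_eq_square)
    show "snd (M1 b g) (b * u) (k, False) = zco_F k u" "snd (M1 b g) (b * u) (k, True) = zco_T k u" for u k
      unfolding zco_F_def zco_T_def r Let_def a using c[folded s_def] g_cases[of k]
      by (elim disjE conjE; simp)+
    show "b * (b * u) = 1 / 2 * (u + b * b * u + b * b * u - b * b * (b * b * u))" for u
      by (simp only: ss) simp
    show "b * b * (b * b * u) = u" for u by (rule ss)
    show "b * b * (b * b * u) = u" for u by (rule ss)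
    show "b * (b * b * u) = b * b * (b * u)" for u by simp
    show "b * (b * b * u) = b * b * (b * u)" for u by simp
    show "snd (M1 b g) (u + v) i = snd (M1 b g) u i + snd (M1 b g) v i" for u v i
      by (cases i) (simp add: r)
    show "snd (M1 b g) (d * u) i = d * snd (M1 b g) u i" for d u i
      by (cases i) (simp add: r)
    show "(\<Sum>k\<in>UNIV. snd (M1 b g) u (k, False)) + (\<Sum>k\<in>UNIV. snd (M1 b g) u (k, True)) = u" for u
      by (simp add: r)
  qed (simp_all add: r distrib_left)
  show ?thesis by (rule is_YD)
qed

section \<open>The odd two-dimensional modules\<close>

text \<open>\<open>sgx\<close> and \<open>sgy\<close> are the characters of the group attached to
  \<open>f_10\<close> and \<open>f_01\<close>. Thus \<open>f_jk\<close> has coordinates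
  \<open>sgx^j sgy^k / 4\<close>.\<close>

definition sgx :: "bool \<times> bool \<Rightarrow> 'k::field" where "sgx g = (if fst g then -1 else 1)"
definition sgy :: "bool \<times> bool \<Rightarrow> 'k::field" where "sgy g = (if snd g then -1 else 1)"

lemma sgx_simps [simp]: "sgx ge = 1" "sgx gx = -1" "sgx gy = 1" "sgx gxy = -1"
  and sgy_simps [simp]: "sgy ge = 1" "sgy gx = 1" "sgy gy = -1" "sgy gxy = -1"
  by (simp_all add: sgx_def sgy_def ge_def gx_def gy_def gxy_def)

lemma hplus_apply: "hplus u v i = u i + v i" and hscal_apply: "hscal c u i = c * u i"
  by (simp_all add: hplus_def hscal_def)

lemma hmul_hscal_left: "hmul (hscal c u) v = hscal c (hmul u v)"
  by (simp add: hmul_def hscal_def sum_distrib_left mult.assoc)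

lemma hmul_hplus_left: "hmul (hplus u u') v = hplus (hmul u v) (hmul u' v)"
  by (simp add: hmul_def hplus_def sum.distrib algebra_simps)

lemma hmul_hbas_F:
  fixes v :: "'k::field h8"
  shows "hmul (hbas (g, False)) v (k, b) = v (gmul g k, b)"
proof -
  have *: "(hbmul (g, False) (m, t) :: 'k h8) (k, b) = (if m = gmul g k \<and> t = b then 1 else 0)" for m t
    by (cases t) (auto simp: hbmul_def hbas_def gmul_ac)
  have "hmul (hbas (g, False)) v (k, b) = (\<Sum>m\<in>UNIV. if m = gmul g k then v (m, b) else 0)"
    unfolding hmul_hbas_left sum_hidx sum.distrib[symmetric]
    by (intro sum.cong refl) (auto simp: *)
  then show ?thesis by simp
qed

lemma hmul_hz: "(\<And>g. u (g, True) = 0) \<Longrightarrow> hmul u hz (k, b) = (if b then u (k, False) else 0)"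
proof -
  assume u: "\<And>g. u (g, True) = 0"
  have "hmul u hz (k, b) = (\<Sum>m\<in>UNIV. if m = k then (if b then u (m, False) else 0) else 0)"
    unfolding hz_def hmul_hbas_right sum_hidx sum.distrib[symmetric]
    by (intro sum.cong refl) (auto simp: u hbmul_def hbas_def)
  then show ?thesis by simp
qed

lemma sgx_gmul [simp]: "sgx (gmul gx g) = - sgx g" "sgx (gmul gy g) = sgx g" "sgx (gmul gxy g) = - sgx g"
  and sgy_gmul [simp]: "sgy (gmul gx g) = sgy g" "sgy (gmul gy g) = - sgy g" "sgy (gmul gxy g) = - sgy g"
  by (simp_all add: sgx_def sgy_def gmul_def gx_def gy_def gxy_def)

lemma sg_sq: "sgx g * sgx g = (1 :: 'k::field)" "sgy g * sgy g = (1 :: 'k)"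
    "sgx g * (sgx g * x) = (x :: 'k::field)" "sgy g * (sgy g * x) = (x :: 'k)"
  by (simp_all add: sgx_def sgy_def)

lemma hf_apply:
  fixes g :: "bool \<times> bool"
  shows "hf 0 0 (g, b) = (if b then 0 else (1::'k::field_char_0)/4)"
  "hf 1 0 (g, b) = (if b then 0 else (1::'k::field_char_0)/4 * sgx g)"
  "hf 0 1 (g, b) = (if b then 0 else (1::'k::field_char_0)/4 * sgy g)"
  "hf 1 1 (g, b) = (if b then 0 else (1::'k::field_char_0)/4 * (sgx g * sgy g))"
proof -
  have *: "hf j k (g, b) = (1/4 :: 'k) * (hplus hone (hscal ((-1)^k) hy) (g, b) + (-1)^j * hplus hone (hscal ((-1)^k) hy) (gmul gx g, b))" for j k
    by (simp add: hf_def hscal_apply hmul_hplus_left hplus_apply hmul_hscal_left hone_def hx_def hmul_hbas_F)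
  show "hf 0 0 (g, b) = (if b then 0 else (1::'k::field_char_0)/4)"
    "hf 1 0 (g, b) = (if b then 0 else (1::'k::field_char_0)/4 * sgx g)"
    "hf 0 1 (g, b) = (if b then 0 else (1::'k::field_char_0)/4 * sgy g)"
    "hf 1 1 (g, b) = (if b then 0 else (1::'k::field_char_0)/4 * (sgx g * sgy g))"
    unfolding * using g_cases[of g]
    by (elim disjE; simp add: hplus_apply hscal_apply hone_def hy_def hbas_def)+
qed

text \<open>\<open>e\<^sub>1 \<mapsto> (f\<^sub>0\<^sub>0 + j f\<^sub>1\<^sub>1) z \<otimes> e\<^sub>1 + (t f\<^sub>1\<^sub>0 + s f\<^sub>0\<^sub>1) z \<otimes> e\<^sub>2\<close> and
  \<open>e\<^sub>2 \<mapsto> (f\<^sub>0\<^sub>0 - j f\<^sub>1\<^sub>1) z \<otimes> e\<^sub>2 + (t' f\<^sub>1\<^sub>0 + s' f\<^sub>0\<^sub>1) z \<otimes> e\<^sub>1\<close>\<close>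

definition odd_co :: "'k::field \<Rightarrow> 'k \<Rightarrow> 'k \<Rightarrow> 'k \<Rightarrow> 'k \<Rightarrow> 'k \<times> 'k \<Rightarrow> hidx \<Rightarrow> 'k \<times> 'k" where
  "odd_co j t s t' s' u i = (if snd i then let a = sgx (fst i); b = sgy (fst i) in
     ((1/4) * ((1 + j * (a * b)) * fst u + (t' * a + s' * b) * snd u),
      (1/4) * ((t * a + s * b) * fst u + (1 - j * (a * b)) * snd u)) else 0)"

lemma snd_WW:
  fixes ii :: "'k::field_char_0"
  shows "snd (WW ii b1 b2) = odd_co (- ii * b1) 1 (ii * b1) 1 (- ii * b1)"
proof (intro ext)
  fix u and i :: hidx
  obtain g b where i: "i = (g, b)" by fastforce
  show "snd (WW ii b1 b2) u i = odd_co (- ii * b1) 1 (ii * b1) 1 (- ii * b1) u i"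
    unfolding i
    by (cases b) (simp_all add: WW_def co2_def tplus_def tens_def hmul_hz hf_apply[simplified] hplus_apply hscal_apply sc2_def
      e1_def e2_def odd_co_def Let_def prod_eq_iff algebra_simps add_divide_distrib)
qed

text \<open>The four group-algebra factors in front of \<open>w\<close> are
  \<open>f_00 - f_11\<close>, \<open>si (f_01 - f_10)\<close>, \<open>f_00 + f_11\<close> and
  \<open>si (f_10 + f_01)\<close>. Multiplied with \<open>w\<close>, the root \<open>si\<close> is
  either squared to \<open>ii\<close> or cancelled by its inverse.\<close>

lemma Wco_eq:
  fixes ii si :: "'k::field_char_0"
  assumes si: "si * si = ii" and si0: "si \<noteq> 0"
  shows "Wco ii si = odd_co (- ii) (- ii) 1 ii 1"
proof (intro ext)
  fix u :: "'k \<times> 'k" and i :: hidx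
  obtain g b where i: "i = (g, b)" by fastforce
  define r where "r = 1 / si"
  have r: "si * r = 1" "si * (r * x) = x" "r * si = 1" "r * (si * x) = x" for x using si0 by (simp_all add: r_def)
  have si': "si * (si * x) = ii * x" for x using si by (simp flip: mult.assoc)
  have hw: "hw ii si (g, b) = (if b then (1/4) * (1 + si * sgx g + r * sgy g + ii * (sgx g * sgy g)) else 0)" for g b
    unfolding hw_def r_def[symmetric]
    by (simp add: hmul_hz hf_apply[simplified] hplus_apply hscal_apply algebra_simps add_divide_distrib)
  have xy: "hmul hx hy = (hbas (gxy, False) :: 'k h8)"
    by (simp add: hx_def hy_def hmul_hbas hbmul_def)
  have e: "Wco ii si u (g, b) = ((1/2) * (hw ii si (gmul gx g, b) + hw ii si (gmul gy g, b)) * fst u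
       + (si / 2) * (hw ii si (g, b) - hw ii si (gmul gxy g, b)) * snd u,
     (si / 2) * (hw ii si (gmul gx g, b) - hw ii si (gmul gy g, b)) * fst u
       + (1/2) * (hw ii si (g, b) + hw ii si (gmul gxy g, b)) * snd u)"
    unfolding Wco_def co2_def tplus_def tens_def xy
    unfolding hmul_hplus_left hmul_hscal_left hone_def hx_def hy_def
    by (simp add: hmul_hbas_F hplus_apply hscal_apply sc2_def e1_def e2_def mult_ac)
  show "Wco ii si u i = odd_co (- ii) (- ii) 1 ii 1 u i"
    unfolding i e
    by (cases b) (simp_all add: hw odd_co_def Let_def prod_eq_iff algebra_simps si si' r add_divide_distrib)
qed

lemma sg_gmul_right [simp]:
  "sgx (gmul g gx) = - sgx g" "sgx (gmul g gy) = sgx g" "sgx (gmul g gxy) = - sgx g"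
  "sgy (gmul g gx) = sgy g" "sgy (gmul g gy) = - sgy g" "sgy (gmul g gxy) = - sgy g"
  "sgx (gsw g) = sgy g" "sgy (gsw g) = sgx g"
  by (simp_all add: sgx_def sgy_def gmul_def gx_def gy_def gxy_def gsw_def)

lemma lmap2_add: "lmap2 p q (u + v) = lmap2 p q u + lmap2 p q v"
  and lmap2_sc2: "lmap2 p q (sc2 c u) = sc2 c (lmap2 p q u)"
  by (simp_all add: lmap2_def sc2_def algebra_simps)

lemma odd_co_F: "odd_co j t s t' s' u (g, False) = 0"
  and odd_co_T: "odd_co j t s t' s' u (g, True) =
    ((1/4) * ((1 + j * (sgx g * sgy g)) * fst u + (t' * sgx g + s' * sgy g) * snd u),
      (1/4) * ((t * sgx g + s * sgy g) * fst u + (1 - j * (sgx g * sgy g)) * snd u))"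
  by (simp_all add: odd_co_def Let_def)

lemma odd_co_add: "odd_co j t s t' s' (u + v) i = odd_co j t s t' s' u i + odd_co j t s t' s' v i"
  and odd_co_sc2: "odd_co j t s t' s' (sc2 c u) i = sc2 c (odd_co j t s t' s' u i)"
  by (simp_all add: odd_co_def Let_def sc2_def prod_eq_iff algebra_simps add_divide_distrib)

lemma odd_co_counit:
  fixes j :: "'k::field_char_0"
  shows "(\<Sum>g\<in>UNIV. odd_co j t s t' s' u (g, False)) + (\<Sum>g\<in>UNIV. odd_co j t s t' s' u (g, True)) = u"
  by (simp add: sum_g odd_co_F odd_co_T prod_eq_iff algebra_simps add_divide_distrib)

text \<open>Here \<open>J = diag(j, -j)\<close>, \<open>T\<close> sends \<open>e1\<close> to
  \<open>t e2\<close> and \<open>e2\<close> to \<open>t' e1\<close>, and the coefficients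
  \<open>- j * t\<close> and \<open>j * t'\<close> are those of \<open>S = J T\<close>. The
  assumptions say \<open>J^2 = -1\<close> and \<open>T^2 = 1\<close>, the defining relations of the
  dual of the matrix coalgebra.\<close>

lemma odd_co_coassoc:
  fixes j t t' :: "'k::field_char_0"
  assumes "j * j = -1" "t * t' = 1"
  defines "R \<equiv> odd_co j t (- j * t) t' (j * t')"
  shows "R (R u (k, True)) (k, True) = sc2 (1/2) (R u (k, True))"
    "R (R u (k, True)) (gmul k gx, True) = sc2 (1/2) (R u (k, True))"
    "R (R u (k, True)) (gmul k gy, True) = sc2 (1/2) (R u (gmul k gy, True))"
    "R (R u (k, True)) (gmul k gxy, True) = - sc2 (1/2) (R u (gmul k gy, True))"
proof -
  have j: "j * (j * x) = - x" for x using assms(1) by (simp flip: mult.assoc)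
  have t: "t' * t = 1" "t * (t' * x) = x" "t' * (t * x) = x" for x using assms(2) by (simp_all add: mult.commute flip: mult.assoc)
  show "R (R u (k, True)) (k, True) = sc2 (1/2) (R u (k, True))"
    "R (R u (k, True)) (gmul k gx, True) = sc2 (1/2) (R u (k, True))"
    "R (R u (k, True)) (gmul k gy, True) = sc2 (1/2) (R u (gmul k gy, True))"
    "R (R u (k, True)) (gmul k gxy, True) = - sc2 (1/2) (R u (gmul k gy, True))"
    unfolding R_def odd_co_T
    by (simp_all add: sc2_def algebra_simps add_divide_distrib diff_divide_distrib sg_sq j t assms(1,2))
qed

text \<open>The even coordinates of \<open>R\<close> vanish, so beyond the module relations only the
  odd compatibility for \<open>z\<close> remains, which is \<open>RZ\<close>. Compatibility with
  \<open>X\<close> and \<open>Y\<close> holds because both are diagonal with opposite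
  entries.\<close>

lemma is_YD_odd_co:
  fixes j t t' x y :: "'k::field_char_0"
  assumes jt: "j * j = -1" "t * t' = 1" and xy: "x = 1 \<or> x = -1" "y = 1 \<or> y = -1"
    and X: "\<And>u. X u = (x * fst u, - x * snd u)" and Y: "\<And>u. Y u = (y * fst u, - y * snd u)"
    and Z: "\<And>u v. Z (u + v) = Z u + Z v" "\<And>c u. Z (sc2 c u) = sc2 c (Z u)"
    and ZX: "\<And>u. Z (X u) = Y (Z u)" and ZY: "\<And>u. Z (Y u) = X (Z u)"
    and ZZ: "\<And>u. Z (Z u) = sc2 (1/2) (u + X u + Y u - X (Y u))"
    and R: "R = odd_co j t (- j * t) t' (j * t')"
    and RZ: "\<And>u k. R (Z u) (k, True) = sc2 (1/2) (Z (R u (gsw k, True)) + Z (R u (gmul (gsw k) gx, True))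
        - X (Y (Z (R u (gmul (gsw k) gy, True)))) + X (Y (Z (R u (gmul (gsw k) gxy, True)))))"
  shows "is_YD sc2 (gen_act X Y Z) R"
proof -
  interpret yd_ops sc2 "gen_act X Y Z" R
    by (intro yd_ops.intro vector_space_sc2)
  have Z0: "Z 0 = 0" using Z(1)[of 0 0] by simp
  have a: "gen_act X Y Z (ge, True) u = Z u" "gen_act X Y Z (gx, True) u = X (Z u)"
     "gen_act X Y Z (gy, True) u = Y (Z u)" "gen_act X Y Z (gxy, True) u = X (Y (Z u))" for u
    by (simp_all add: gen_act_def ge_def gx_def gy_def gxy_def)
  have rF: "R u (g, False) = 0" for u g by (simp add: R odd_co_F)
  have x: "x * (x * d) = d" and y: "y * (y * d) = d" for d
    using xy by auto
  interpret yd_reduced sc2 "gen_act X Y Z" R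
  proof (rule yd_reducedI[where X = X and Y = Y and Z = Z])
    show "R (Z u) (k, False) = zco_F k u" "R (Z u) (k, True) = zco_T k u" for u k
      unfolding zco_F_def zco_T_def Let_def a RZ rF by (simp_all add: Z0 X Y flip: zero_prod_def)
    show "R (R u (k, True)) (k, True) = sc2 (1/2) (R u (k, True))"
      "R (R u (k, True)) (gmul k gx, True) = sc2 (1/2) (R u (k, True))"
      "R (R u (k, True)) (gmul k gy, True) = sc2 (1/2) (R u (gmul k gy, True))"
      "R (R u (k, True)) (gmul k gxy, True) = - sc2 (1/2) (R u (gmul k gy, True))" for u k
      unfolding R by (rule odd_co_coassoc[OF jt])+
    show "R (u + v) i = R u i + R v i" "R (sc2 c u) i = sc2 c (R u i)" for u v c i
      unfolding R by (rule odd_co_add odd_co_sc2)+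
    show "(\<Sum>g\<in>UNIV. R u (g, False)) + (\<Sum>g\<in>UNIV. R u (g, True)) = u" for u
      unfolding R by (rule odd_co_counit)
    show "Z (u + v) = Z u + Z v" "Z (sc2 c u) = sc2 c (Z u)" "Z (X u) = Y (Z u)" "Z (Y u) = X (Z u)"
      "Z (Z u) = sc2 (1/2) (u + X u + Y u - X (Y u))" for u v c
      by (rule Z ZX ZY ZZ)+
    show "R (X u) (k, False) = X (R u (k, False))" "R (X u) (k, True) = X (R u (gmul k gxy, True))"
      "R (Y u) (k, False) = Y (R u (k, False))" "R (Y u) (k, True) = Y (R u (gmul k gxy, True))" for u k
      by (simp_all add: rF X Y flip: zero_prod_def) (simp_all add: R odd_co_T algebra_simps)
    show "R (R u (j, False)) (k, True) = 0" for u j k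
      by (simp add: rF) (simp add: R odd_co_def Let_def flip: zero_prod_def)
  qed (simp_all add: X Y x y rF sc2_def prod_eq_iff algebra_simps)
  show ?thesis by (rule is_YD)
qed

lemma is_YD_WW:
  fixes ii b1 b2 :: "'k::field_char_0"
  assumes ii: "ii * ii = -1" and b: "b1 = 1 \<or> b1 = -1" "b2 = 1 \<or> b2 = -1"
  shows "is_YD sc2 (fst (WW ii b1 b2)) (snd (WW ii b1 b2))"
proof -
  have ii': "ii * (ii * x) = - x" for x using ii by (simp flip: mult.assoc)
  have b': "b1 * b1 = 1" "b1 * (b1 * x) = x" "b2 * b2 = 1" "b2 * (b2 * x) = x" for x using b by auto
  have l: "lmap2 e1 (- e2) u = (fst u, - snd u)"
    "lmap2 (sc2 b2 e1) (sc2 (- ii * b1 * b2) e2) u = (b2 * fst u, - (ii * b1 * b2) * snd u)" for u :: "'k \<times> 'k"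
    by (simp_all add: lmap2_def e1_def e2_def sc2_def)
  show ?thesis
    unfolding WW_def fst_conv
    unfolding snd_WW[of ii b1 b2, unfolded WW_def]
  proof (rule is_YD_odd_co[where x = 1 and y = 1 and t = 1 and t' = 1 and j = "- ii * b1"])
    fix u :: "'k \<times> 'k" and k
    show "odd_co (- ii * b1) 1 (ii * b1) 1 (- ii * b1) = odd_co (- ii * b1) 1 (- (- ii * b1) * 1) 1 (- ii * b1 * 1)"
      by simp
    show "odd_co (- ii * b1) 1 (ii * b1) 1 (- ii * b1) (lmap2 (sc2 b2 e1) (sc2 (- ii * b1 * b2) e2) u) (k, True) =
      sc2 (1/2) (lmap2 (sc2 b2 e1) (sc2 (- ii * b1 * b2) e2) (odd_co (- ii * b1) 1 (ii * b1) 1 (- ii * b1) u (gsw k, True))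
       + lmap2 (sc2 b2 e1) (sc2 (- ii * b1 * b2) e2) (odd_co (- ii * b1) 1 (ii * b1) 1 (- ii * b1) u (gmul (gsw k) gx, True))
       - lmap2 e1 (- e2) (lmap2 e1 (- e2) (lmap2 (sc2 b2 e1) (sc2 (- ii * b1 * b2) e2) (odd_co (- ii * b1) 1 (ii * b1) 1 (- ii * b1) u (gmul (gsw k) gy, True))))
       + lmap2 e1 (- e2) (lmap2 e1 (- e2) (lmap2 (sc2 b2 e1) (sc2 (- ii * b1 * b2) e2) (odd_co (- ii * b1) 1 (ii * b1) 1 (- ii * b1) u (gmul (gsw k) gxy, True)))))"
      unfolding l odd_co_T by (simp add: sc2_def algebra_simps add_divide_distrib diff_divide_distrib ii' ii b')
  qed (simp_all add: lmap2_def e1_def e2_def b' ii ii' sc2_def prod_eq_iff algebra_simps)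
qed

text \<open>Since \<open>xy\<close> acts by -1, \<open>z^2\<close> acts by 1, that is
  \<open>l1 * l2 = 1\<close>. As \<open>l1 * l2 = s * s / 2\<close>, this is where
  \<open>s = a + 1\<close> has to be a square root of 2.\<close>

lemma is_YD_W:
  fixes ii s \<sigma> :: "'k::field_char_0"
  assumes ii: "ii * ii = -1" and s: "s * s = 2" and \<sigma>: "\<sigma> = 1 \<or> \<sigma> = -1"
    and l1: "l1 = 1/2 * (1 - ii) * s" and l2: "l2 = 1/2 * (1 + ii) * s"
  shows "is_YD sc2 (gen_act (lmap2 (sc2 (- \<sigma>) e1) (sc2 \<sigma> e2)) (lmap2 (sc2 \<sigma> e1) (sc2 (- \<sigma>) e2))
    (lmap2 (sc2 l1 e2) (sc2 l2 e1))) (odd_co (- ii) (- ii) 1 ii 1)"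
proof -
  have ii': "ii * (ii * x) = - x" for x using ii by (simp flip: mult.assoc)
  have l12: "l2 = ii * l1" unfolding l1 l2 by (simp add: algebra_simps ii ii' add_divide_distrib diff_divide_distrib)
  have ll: "l1 * l1 = - ii" unfolding l1 by (simp add: algebra_simps ii ii' s)
  have ll': "l1 * (l1 * x) = - ii * x" for x using ll by (simp flip: mult.assoc)
  have sg: "\<sigma> * \<sigma> = 1" "\<sigma> * (\<sigma> * x) = x" for x using \<sigma> by auto
  have l: "lmap2 (sc2 a e1) (sc2 b e2) u = (a * fst u, b * snd u)"
    "lmap2 (sc2 l1 e2) (sc2 l2 e1) u = (ii * l1 * snd u, l1 * fst u)" for u :: "'k \<times> 'k" and a b
    by (simp_all add: lmap2_def e1_def e2_def sc2_def l12)
  show ?thesis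
  proof (rule is_YD_odd_co[where x = "- \<sigma>" and y = \<sigma> and t = "- ii" and t' = ii and j = "- ii"])
    fix u :: "'k \<times> 'k" and k
    let ?R = "odd_co (- ii) (- ii) 1 ii 1"
    let ?X = "lmap2 (sc2 (- \<sigma>) e1) (sc2 \<sigma> e2)" and ?Y = "lmap2 (sc2 \<sigma> e1) (sc2 (- \<sigma>) e2)"
    let ?Z = "lmap2 (sc2 l1 e2) (sc2 l2 e1)"
    show "?R (?Z u) (k, True) = sc2 (1/2) (?Z (?R u (gsw k, True)) + ?Z (?R u (gmul (gsw k) gx, True))
        - ?X (?Y (?Z (?R u (gmul (gsw k) gy, True)))) + ?X (?Y (?Z (?R u (gmul (gsw k) gxy, True)))))"
      unfolding l odd_co_T by (simp add: sc2_def algebra_simps add_divide_distrib diff_divide_distrib ii' ii sg)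
  qed (use \<sigma> in \<open>auto simp: lmap2_def e1_def e2_def l12 ll ll' ii ii' sg sc2_def prod_eq_iff algebra_simps\<close>)
qed

section \<open>Even two-dimensional modules\<close>

definition even2 :: "'k::field \<Rightarrow> 'k \<Rightarrow> 'k \<Rightarrow> bool \<times> bool \<Rightarrow> bool \<times> bool
    \<Rightarrow> (hidx \<Rightarrow> 'k \<times> 'k \<Rightarrow> 'k \<times> 'k) \<times> ('k \<times> 'k \<Rightarrow> hidx \<Rightarrow> 'k \<times> 'k)" where
  "even2 \<alpha> \<beta> c g g' = (gen_act (lmap2 (sc2 \<alpha> e1) (sc2 \<beta> e2)) (lmap2 (sc2 \<beta> e1) (sc2 \<alpha> e2))
     (lmap2 (sc2 c e2) (sc2 c e1)), diagco g g')"

text \<open>In each row \<open>g'\<close> is the degree forced on \<open>z p_1\<close>, and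
  \<open>c * c\<close> is the eigenvalue of \<open>z^2\<close> determined by \<alpha> and
  \<beta>.\<close>

definition even2_datum :: "'k::field \<Rightarrow> 'k \<Rightarrow> 'k \<Rightarrow> bool \<times> bool \<Rightarrow> bool \<times> bool \<Rightarrow> bool" where
  "even2_datum \<alpha> \<beta> c g g' \<longleftrightarrow>
     \<alpha> = -1 \<and> \<beta> = -1 \<and> c * c = -1 \<and> g = ge \<and> g' = gxy
   \<or> \<alpha> = 1 \<and> \<beta> = 1 \<and> c * c = 1 \<and> g = gx \<and> g' = gy
   \<or> \<alpha> = 1 \<and> \<beta> = -1 \<and> c * c = 1 \<and> g = ge \<and> g' = gy
   \<or> \<alpha> = 1 \<and> \<beta> = -1 \<and> c * c = 1 \<and> g = gx \<and> g' = ge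
   \<or> \<alpha> = 1 \<and> \<beta> = -1 \<and> c * c = 1 \<and> g = gxy \<and> g' = gx
   \<or> \<alpha> = 1 \<and> \<beta> = -1 \<and> c * c = 1 \<and> g = gy \<and> g' = gxy"

lemma co2_add: "co2 p q (u + v) i = co2 p q u i + co2 p q v i"
  and co2_sc2: "co2 p q (sc2 c u) i = sc2 c (co2 p q u i)"
  by (simp_all add: co2_def sc2_def algebra_simps)

lemma is_YD_even2:
  fixes \<alpha> \<beta> c :: "'k::field_char_0"
  assumes d: "even2_datum \<alpha> \<beta> c g g'"
  shows "is_YD sc2 (fst (even2 \<alpha> \<beta> c g g')) (snd (even2 \<alpha> \<beta> c g g'))"
proof -
  define A where "A = fst (even2 \<alpha> \<beta> c g g')"
  define R where "R = snd (even2 \<alpha> \<beta> c g g')"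
  interpret yd_ops sc2 A R
    by (intro yd_ops.intro vector_space_sc2)
  have r: "R u (k, t) = (if k = g \<and> \<not> t then fst u else 0, if k = g' \<and> \<not> t then snd u else 0)" for u k t
    by (auto simp: R_def even2_def diagco_def co2_def tens_def hbas_def sc2_def e1_def e2_def)
  have X: "lmap2 (sc2 \<alpha> e1) (sc2 \<beta> e2) u = (\<alpha> * fst u, \<beta> * snd u)"
    and Y: "lmap2 (sc2 \<beta> e1) (sc2 \<alpha> e2) u = (\<beta> * fst u, \<alpha> * snd u)"
    and Z: "lmap2 (sc2 c e2) (sc2 c e1) u = (c * snd u, c * fst u)" for u
    by (simp_all add: lmap2_def sc2_def e1_def e2_def)
  have a: "A (ge, True) u = (c * snd u, c * fst u)" "A (gx, True) u = (\<alpha> * (c * snd u), \<beta> * (c * fst u))"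
     "A (gy, True) u = (\<beta> * (c * snd u), \<alpha> * (c * fst u))"
     "A (gxy, True) u = (\<alpha> * (\<beta> * (c * snd u)), \<beta> * (\<alpha> * (c * fst u)))" for u
    by (simp_all add: A_def even2_def gen_act_def ge_def gx_def gy_def gxy_def X Y Z)
  have \<alpha>: "\<alpha> * (\<alpha> * x) = x" and \<beta>: "\<beta> * (\<beta> * x) = x"
    and c: "c * (c * x) = 1 / 2 * (x + \<alpha> * x + \<beta> * x - \<alpha> * (\<beta> * x))" for x
    using d unfolding even2_datum_def by (elim disjE conjE; simp flip: mult.assoc)+
  have gg: "g \<noteq> g'" using d unfolding even2_datum_def by auto
  interpret yd_reduced sc2 A R
  proof (rule yd_reducedI[where X = "lmap2 (sc2 \<alpha> e1) (sc2 \<beta> e2)" and Y = "lmap2 (sc2 \<beta> e1) (sc2 \<alpha> e2)"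
        and Z = "lmap2 (sc2 c e2) (sc2 c e1)"])
    show "A = gen_act (lmap2 (sc2 \<alpha> e1) (sc2 \<beta> e2)) (lmap2 (sc2 \<beta> e1) (sc2 \<alpha> e2)) (lmap2 (sc2 c e2) (sc2 c e1))"
      by (simp add: A_def even2_def)
    show "R (lmap2 (sc2 c e2) (sc2 c e1) u) (k, False) = zco_F k u"
         "R (lmap2 (sc2 c e2) (sc2 c e1) u) (k, True) = zco_T k u" for u k
      unfolding zco_F_def zco_T_def r Let_def a Z using d[unfolded even2_datum_def] g_cases[of k]
      by (elim disjE conjE; simp add: sc2_def)+
    show "(\<Sum>k\<in>UNIV. R u (k, False)) + (\<Sum>k\<in>UNIV. R u (k, True)) = u" for u
      using gg g_cases[of g] g_cases[of g'] unfolding r by (elim disjE; simp add: sum_g flip: zero_prod_def)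
    show "R (u + v) i = R u i + R v i" "R (sc2 b u) i = sc2 b (R u i)" for u v b i
      by (simp_all add: R_def even2_def diagco_def co2_add co2_sc2)
    show "lmap2 (sc2 c e2) (sc2 c e1) (lmap2 (sc2 c e2) (sc2 c e1) u) = sc2 (1/2) (u
        + lmap2 (sc2 \<alpha> e1) (sc2 \<beta> e2) u + lmap2 (sc2 \<beta> e1) (sc2 \<alpha> e2) u
        - lmap2 (sc2 \<alpha> e1) (sc2 \<beta> e2) (lmap2 (sc2 \<beta> e1) (sc2 \<alpha> e2) u))" for u
      unfolding X Y Z by (simp add: prod_eq_iff sc2_def c mult.left_commute[of \<beta> \<alpha>])
    show "R (R u (j, False)) (k, False) = (if j = k then R u (j, False) else 0)"
      "R (R u (j, False)) (k, True) = 0" "R (R u (j, True)) (k, False) = 0"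
      "R (R u (j, True)) (j, True) = sc2 (1/2) (R u (j, True))"
      "R (R u (j, True)) (gmul j gx, True) = sc2 (1/2) (R u (j, True))"
      "R (R u (j, True)) (gmul j gy, True) = sc2 (1/2) (R u (gmul j gy, True))"
      "R (R u (j, True)) (gmul j gxy, True) = - sc2 (1/2) (R u (gmul j gy, True))" for u j k
      by (auto simp: r sc2_def prod_eq_iff)
  qed (simp_all add: lmap2_add lmap2_sc2, simp_all add: r X Y Z \<alpha> \<beta> prod_eq_iff)
  show ?thesis using is_YD by (simp only: A_def R_def)
qed

section \<open>Simplicity and isomorphisms\<close>

definition odd2 :: "'k::field \<Rightarrow> 'k \<Rightarrow> 'k
    \<Rightarrow> (hidx \<Rightarrow> 'k \<times> 'k \<Rightarrow> 'k \<times> 'k) \<times> ('k \<times> 'k \<Rightarrow> hidx \<Rightarrow> 'k \<times> 'k)" where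
  "odd2 ii \<sigma> s = (gen_act (lmap2 (sc2 (- \<sigma>) e1) (sc2 \<sigma> e2)) (lmap2 (sc2 \<sigma> e1) (sc2 (- \<sigma>) e2))
    (lmap2 (sc2 (1/2 * (1 - ii) * s) e2) (sc2 (1/2 * (1 + ii) * s) e1)), odd_co (- ii) (- ii) 1 ii 1)"

text \<open>\<open>OddM \<sigma> s\<close> stands for \<open>W\<^sub>1\<^sup>a\<close> (\<open>\<sigma> = 1\<close>) or \<open>W\<^sub>2\<^sup>a\<close> (\<open>\<sigma> = -1\<close>) with \<open>s = a + 1\<close>.\<close>

datatype 'k label = Even 'k 'k "bool \<times> bool" "bool \<times> bool" | OddP 'k 'k | OddM 'k 'k

fun ymod where
  "ymod ii (Even \<alpha> \<beta> g g') = even2 \<alpha> \<beta> (if \<alpha> = -1 \<and> \<beta> = -1 then ii else 1) g g'"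
| "ymod ii (OddP b1 b2) = WW ii b1 b2"
| "ymod ii (OddM \<sigma> s) = odd2 ii \<sigma> s"

text \<open>Labels turn equality of modules, which are pairs of functions, into equality of
  parameters. The order is that of \<open>twod\<close>, so positions correspond, and each orbit of
  even data under \<open>z\<close> has one representative.\<close>

definition labels :: "'k::field \<Rightarrow> 'k label list" where
  "labels s2 = [Even (-1) (-1) ge gxy, Even 1 1 gx gy, Even 1 (-1) ge gy, Even 1 (-1) gx ge,
     Even 1 (-1) gxy gx, Even 1 (-1) gy gxy, OddP 1 1, OddP 1 (-1), OddP (-1) 1, OddP (-1) (-1),
     OddM 1 s2, OddM 1 (- s2), OddM (-1) s2, OddM (-1) (- s2)]"

definition labels1 :: "'k::field \<Rightarrow> ('k \<times> (bool \<times> bool)) list" where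
  "labels1 ii = [(1, ge), (-1, ge), (1, gxy), (-1, gxy), (ii, gx), (-ii, gx), (ii, gy), (-ii, gy)]"

lemma oned_eq: "oned ii = map (\<lambda>(b, g). M1 b g) (labels1 ii)"
  by (simp add: oned_def labels1_def)

lemma sc2_simps: "sc2 1 u = u" "sc2 (-1) u = - u"
  by (simp_all add: sc2_def prod_eq_iff)

lemma twod_eq:
  fixes ii :: "'k::field_char_0"
  assumes "si * si = ii" "si \<noteq> 0"
  shows "twod ii s2 si = map (ymod ii) (labels s2)"
  by (simp add: twod_def labels_def M1xy_def Mxy_def Mg_def even2_def W1_def W2_def odd2_def Wz_def
      Wco_eq[OF assms] sc2_simps)

lemma distinct_labels:
  fixes s2 :: "'k::field_char_0"
  assumes "s2 \<noteq> 0" shows "distinct (labels s2)"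
proof -
  have "(1::'k) \<noteq> -1" "s2 \<noteq> - s2" "-s2 \<noteq> s2" "(-1::'k) \<noteq> 1" using assms by (simp_all add: eq_neg_iff_add_eq_0 neg_eq_iff_add_eq_0 flip: mult_2)
  then show ?thesis by (simp add: labels_def)
qed

lemma distinct_labels1:
  fixes ii :: "'k::field_char_0"
  assumes "ii * ii = -1" shows "distinct (labels1 ii)"
proof -
  have "ii \<noteq> 0" using assms by auto
  then have "(1::'k) \<noteq> -1" "ii \<noteq> - ii" "-ii \<noteq> ii" "(-1::'k) \<noteq> 1" by (simp_all add: eq_neg_iff_add_eq_0 neg_eq_iff_add_eq_0 flip: mult_2)
  then show ?thesis by (simp add: labels1_def)
qed

lemma is_YD_labels1:
  fixes ii :: "'k::field_char_0"
  assumes "ii * ii = -1" "(b, g) \<in> set (labels1 ii)"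
  shows "is_YD (*) (fst (M1 b g)) (snd (M1 b g))"
  by (rule is_YD_M1) (use assms in \<open>auto simp: labels1_def\<close>)

lemma is_YD_labels:
  fixes ii :: "'k::field_char_0"
  assumes ii: "ii * ii = -1" and s: "s2 * s2 = 2" and p: "p \<in> set (labels s2)"
  shows "is_YD sc2 (fst (ymod ii p)) (snd (ymod ii p))"
proof (cases p)
  case (Even \<alpha> \<beta> g g')
  have "even2_datum \<alpha> \<beta> (if \<alpha> = -1 \<and> \<beta> = -1 then ii else 1) g g'"
    using p ii unfolding Even labels_def even2_datum_def by auto
  from is_YD_even2[OF this] show ?thesis unfolding Even ymod.simps .
next
  case (OddP b1 b2)
  show ?thesis
    using p unfolding OddP ymod.simps by (intro is_YD_WW ii) (auto simp: labels_def)
next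
  case (OddM \<sigma> s)
  have "s * s = 2" "\<sigma> = 1 \<or> \<sigma> = -1" using p s by (auto simp: OddM labels_def)
  from is_YD_W[OF ii this refl refl] show ?thesis unfolding OddM ymod.simps odd2_def by simp
qed

section \<open>Simplicity of the models\<close>

lemma yd_simple_1:
  fixes A :: "hidx \<Rightarrow> 'k::field \<Rightarrow> 'k"
  assumes "is_YD (*) A R"
  shows "yd_simple (*) A R"
proof -
  have "W = UNIV" if W: "yd_sub (*) A R W" "W \<noteq> {0}" for W
  proof -
    obtain u where u: "u \<in> W" "u \<noteq> 0" using W unfolding yd_sub_def by blast
    have "(c / u) * u \<in> W" for c using W(1) u(1) unfolding yd_sub_def by blast
    with u(2) show ?thesis by auto
  qed
  moreover have "(UNIV :: 'k set) \<noteq> {0}" by (metis UNIV_I singletonD zero_neq_one)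
  ultimately show ?thesis using assms unfolding yd_simple_def by blast
qed

text \<open>Closure under both coordinate projections puts a multiple of some basis vector into any
  nonzero subobject; the last assumption supplies the other one.\<close>

lemma yd_simple_2:
  fixes A :: "hidx \<Rightarrow> 'k::field \<times> 'k \<Rightarrow> 'k \<times> 'k"
  assumes "is_YD sc2 A R"
    and 1: "\<And>W u. yd_sub sc2 A R W \<Longrightarrow> u \<in> W \<Longrightarrow> (fst u, 0) \<in> W"
    and 2: "\<And>W u. yd_sub sc2 A R W \<Longrightarrow> u \<in> W \<Longrightarrow> (0, snd u) \<in> W"
    and 12: "\<And>W. yd_sub sc2 A R W \<Longrightarrow> (1, 0) \<in> W \<longleftrightarrow> (0, 1) \<in> W"
  shows "yd_simple sc2 A R"
proof -
  have "W = UNIV" if W: "yd_sub sc2 A R W" "W \<noteq> {0}" for W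
  proof -
    have sc: "u \<in> W \<Longrightarrow> sc2 c u \<in> W" and add: "u \<in> W \<Longrightarrow> v \<in> W \<Longrightarrow> u + v \<in> W" for c u v
      using W(1) unfolding yd_sub_def by blast+
    obtain u where u: "u \<in> W" "u \<noteq> 0" using W unfolding yd_sub_def by blast
    have "(1, 0) \<in> W \<or> (0, 1) \<in> W"
    proof (cases "fst u = 0")
      case True
      with u(2) have "snd u \<noteq> 0" by (auto simp: prod_eq_iff)
      then show ?thesis using sc[OF 2[OF W(1) u(1)], of "1 / snd u"] by (simp add: sc2_def)
    next
      case False
      then show ?thesis using sc[OF 1[OF W(1) u(1)], of "1 / fst u"] by (simp add: sc2_def)
    qed
    with 12[OF W(1)] have e: "(1, 0) \<in> W" "(0, 1) \<in> W" by auto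
    have "(a, b) \<in> W" for a b
      using add[OF sc[OF e(1), of a] sc[OF e(2), of b]] by (simp add: sc2_def)
    then show ?thesis by auto
  qed
  moreover have "(1, 0) \<noteq> (0 :: 'k \<times> 'k)" by (simp add: zero_prod_def)
  then have "(UNIV :: ('k \<times> 'k) set) \<noteq> {0}" by (metis UNIV_I singletonD)
  ultimately show ?thesis using assms(1) unfolding yd_simple_def by blast
qed

lemma yd_sub_D:
  assumes "yd_sub sc A R W"
  shows "u \<in> W \<Longrightarrow> v \<in> W \<Longrightarrow> u + v \<in> W" "u \<in> W \<Longrightarrow> sc c u \<in> W"
    "u \<in> W \<Longrightarrow> A i u \<in> W" "u \<in> W \<Longrightarrow> R u i \<in> W"
  using assms unfolding yd_sub_def by blast+

lemma even2_R:
  "snd (even2 \<alpha> \<beta> c g g') u (k, t) = (if k = g \<and> \<not> t then fst u else 0, if k = g' \<and> \<not> t then snd u else 0)"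
  by (auto simp: even2_def diagco_def co2_def tens_def hbas_def sc2_def e1_def e2_def)

lemma even2_A:
  "fst (even2 \<alpha> \<beta> c g g') (gx, False) u = (\<alpha> * fst u, \<beta> * snd u)"
  "fst (even2 \<alpha> \<beta> c g g') (gy, False) u = (\<beta> * fst u, \<alpha> * snd u)"
  "fst (even2 \<alpha> \<beta> c g g') (ge, True) u = (c * snd u, c * fst u)"
  by (simp_all add: even2_def gen_act_def ge_def gx_def gy_def lmap2_def sc2_def e1_def e2_def)

lemma odd2_R: "snd (odd2 ii \<sigma> s) = odd_co (- ii) (- ii) 1 ii 1"
  by (simp add: odd2_def)

lemma WW_A:
  "fst (WW ii b1 b2) (gx, False) u = (fst u, - snd u)"
  "fst (WW ii b1 b2) (gy, False) u = (fst u, - snd u)"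
  "fst (WW ii b1 b2) (gxy, False) u = (fst u, snd u)"
  "fst (WW ii b1 b2) (ge, True) u = (b2 * fst u, - (ii * b1 * b2) * snd u)"
  by (simp_all add: WW_def gen_act_def ge_def gx_def gy_def gxy_def lmap2_def sc2_def e1_def e2_def)

lemma odd2_A:
  "fst (odd2 ii \<sigma> s) (gx, False) u = (- \<sigma> * fst u, \<sigma> * snd u)"
  "fst (odd2 ii \<sigma> s) (gy, False) u = (\<sigma> * fst u, - \<sigma> * snd u)"
  "fst (odd2 ii \<sigma> s) (gxy, False) u = (- (\<sigma> * \<sigma>) * fst u, - (\<sigma> * \<sigma>) * snd u)"
  "fst (odd2 ii \<sigma> s) (ge, True) u = (1/2 * (1 + ii) * s * snd u, 1/2 * (1 - ii) * s * fst u)"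
  by (simp_all add: odd2_def gen_act_def ge_def gx_def gy_def gxy_def lmap2_def sc2_def e1_def e2_def)

text \<open>\<open>opT\<close> and \<open>opJ\<close>, and \<open>opS\<close> below, contract the coaction with the coordinate
  functionals of \<open>f\<^sub>1\<^sub>0 z\<close>, \<open>f\<^sub>1\<^sub>1 z\<close> and \<open>f\<^sub>0\<^sub>1 z\<close>.\<close>

definition opT :: "('v \<Rightarrow> hidx \<Rightarrow> 'v::ab_group_add) \<Rightarrow> 'v \<Rightarrow> 'v" where
  "opT R u = R u (ge, True) - R u (gx, True) + R u (gy, True) - R u (gxy, True)"

definition opJ :: "('v \<Rightarrow> hidx \<Rightarrow> 'v::ab_group_add) \<Rightarrow> 'v \<Rightarrow> 'v" where
  "opJ R u = R u (ge, True) - R u (gx, True) - R u (gy, True) + R u (gxy, True)"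

lemma opT_odd_co: "opT (odd_co j t s t' s') u = (t' * snd u, t * fst u :: 'k::field_char_0)"
  by (simp add: opT_def odd_co_T prod_eq_iff algebra_simps add_divide_distrib diff_divide_distrib)

lemma opJ_odd_co: "opJ (odd_co j t s t' s') u = (j * fst u, - j * snd u :: 'k::field_char_0)"
  by (simp add: opJ_def odd_co_T prod_eq_iff algebra_simps add_divide_distrib diff_divide_distrib)

text \<open>As \<open>g\<close> and \<open>g'\<close> differ, the coaction itself provides the
  coordinate projections, and \<open>z\<close> exchanges the two lines.\<close>

lemma yd_simple_even2:
  fixes c :: "'k::field_char_0"
  assumes YD: "is_YD sc2 (fst (even2 \<alpha> \<beta> c g g')) (snd (even2 \<alpha> \<beta> c g g'))" and "g \<noteq> g'" "c \<noteq> 0"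
  shows "yd_simple sc2 (fst (even2 \<alpha> \<beta> c g g')) (snd (even2 \<alpha> \<beta> c g g'))"
proof (rule yd_simple_2[OF YD])
  fix W u
  assume "yd_sub sc2 (fst (even2 \<alpha> \<beta> c g g')) (snd (even2 \<alpha> \<beta> c g g')) W"
  note sub = yd_sub_D[OF this]
  show "(1, 0) \<in> W \<longleftrightarrow> (0, 1) \<in> W"
    using sub(2)[OF sub(3)[of "(1,0)" "(ge, True)"], of "1/c"] sub(2)[OF sub(3)[of "(0,1)" "(ge, True)"], of "1/c"] \<open>c \<noteq> 0\<close>
    by (auto simp: even2_A sc2_def)
  assume "u \<in> W"
  then show "(fst u, 0) \<in> W" "(0, snd u) \<in> W"
    using sub(4)[of u "(g, False)"] sub(4)[of u "(g', False)"] \<open>g \<noteq> g'\<close> by (auto simp: even2_R)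
qed

text \<open>The generator \<open>x\<close> has distinct eigenvalues on the two lines, so
  \<open>(1 + x)/2\<close> and \<open>(1 - x)/2\<close> are the projections up to order;
  \<open>opT\<close> exchanges the lines.\<close>

lemma yd_simple_odd_co:
  fixes x :: "'k::field_char_0"
  assumes YD: "is_YD sc2 A R" and R: "R = odd_co j t s t' s'" and t: "t * t' = 1"
    and A: "\<And>u. A (gx, False) u = (x * fst u, - x * snd u)" and x: "x = 1 \<or> x = -1"
  shows "yd_simple sc2 A R"
proof (rule yd_simple_2[OF YD])
  fix W u
  assume W: "yd_sub sc2 A R W"
  note sub = yd_sub_D[OF this]
  have diff: "u - v \<in> W" if "u \<in> W" "v \<in> W" for u v
    using sub(1)[OF that(1) sub(2)[OF that(2), of "-1"]] by (simp add: sc2_simps)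
  have T: "opT R u \<in> W" if "u \<in> W" for u
    unfolding opT_def using that by (intro sub diff)
  have "t \<noteq> 0" "t' \<noteq> 0" using t by auto
  then show "(1, 0) \<in> W \<longleftrightarrow> (0, 1) \<in> W"
    using sub(2)[OF T[of "(1,0)"], of "1/t"] sub(2)[OF T[of "(0,1)"], of "1/t'"]
    by (auto simp: R opT_odd_co sc2_def)
  assume u: "u \<in> W"
  have "sc2 (1/2) (u + sc2 x (A (gx, False) u)) \<in> W" "sc2 (1/2) (u - sc2 x (A (gx, False) u)) \<in> W"
    using u by (intro sub diff; simp)+
  then show "(fst u, 0) \<in> W" "(0, snd u) \<in> W"
    using x by (auto simp: A sc2_def)
qed

lemma yd_simple_labels:
  fixes ii :: "'k::field_char_0"
  assumes ii: "ii * ii = -1" and s: "s2 * s2 = 2" and p: "p \<in> set (labels s2)"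
  shows "yd_simple sc2 (fst (ymod ii p)) (snd (ymod ii p))"
proof (cases p)
  case (Even \<alpha> \<beta> g g')
  have "ii \<noteq> 0" using ii by auto
  moreover have "g \<noteq> g'" using p by (auto simp: Even labels_def)
  ultimately show ?thesis
    using is_YD_labels[OF assms] unfolding Even ymod.simps by (intro yd_simple_even2) auto
next
  case (OddP b1 b2)
  show ?thesis
    using is_YD_labels[OF assms] unfolding OddP ymod.simps
    by (rule yd_simple_odd_co[OF _ snd_WW, where x = 1]) (simp_all add: WW_A)
next
  case (OddM \<sigma> s)
  have "\<sigma> = 1 \<or> \<sigma> = -1" using p s by (auto simp: OddM labels_def)
  then show ?thesis
    using is_YD_labels[OF assms] ii unfolding OddM ymod.simps
    by (intro yd_simple_odd_co[where x = "- \<sigma>" and t = "- ii" and t' = ii]) (auto simp: odd2_A odd2_R)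
qed

section \<open>Isomorphisms and Schur's lemma\<close>

lemma yd_iso_sym_trans:
  assumes "yd_iso sc A R sc1 A1 R1" "yd_iso sc A R sc' A' R'"
  shows "yd_iso sc1 A1 R1 sc' A' R'"
proof -
  obtain f where f: "bij f" "\<And>u v. f (u + v) = f u + f v" "\<And>c u. f (sc c u) = sc1 c (f u)"
    "\<And>i u. f (A i u) = A1 i (f u)" "\<And>u i. f (R u i) = R1 (f u) i"
    using assms(1) unfolding yd_iso_def by metis
  obtain h where h: "bij h" "\<And>u v. h (u + v) = h u + h v" "\<And>c u. h (sc c u) = sc' c (h u)"
    "\<And>i u. h (A i u) = A' i (h u)" "\<And>u i. h (R u i) = R' (h u) i"
    using assms(2) unfolding yd_iso_def by metis
  define f' where "f' = inv f"
  have f': "f' (f u) = u" "f (f' w) = w" for u w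
    using f(1) by (simp_all add: f'_def bij_is_inj bij_is_surj surj_f_inv_f)
  have "f' (u + v) = f' u + f' v" "f' (sc1 c u) = sc c (f' u)" "f' (A1 i u) = A i (f' u)"
    "f' (R1 u i) = R (f' u) i" for u v c i
    using f(2)[of "f' u" "f' v"] f(3)[of c "f' u"] f(4)[of i "f' u"] f(5)[of "f' u" i] f' by metis+
  moreover have "bij f'" using f(1) by (simp add: f'_def bij_imp_bij_inv)
  ultimately show ?thesis unfolding yd_iso_def
    by (intro exI[of _ "h \<circ> f'"]) (use h in \<open>auto intro: bij_comp\<close>)
qed

lemma yd_iso_refl: "yd_iso sc A R sc A R"
  unfolding yd_iso_def by (intro exI[of _ id]) auto

lemma yd_iso_sym: "yd_iso sc A R sc1 A1 R1 \<Longrightarrow> yd_iso sc1 A1 R1 sc A R"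
  by (rule yd_iso_sym_trans[OF _ yd_iso_refl])

text \<open>Kernel and range of \<open>f\<close> are subobjects. The conclusion points backwards
  because morphisms are easiest to build out of an explicit model, while the classification wants
  isomorphisms from the unknown module.\<close>

lemma schur_yd_iso:
  assumes s1: "yd_simple sc1 A1 R1" and s2: "yd_simple sc' A' R'"
    and f: "\<And>u v. f (u + v) = f u + f v" "\<And>c u. f (sc1 c u) = sc' c (f u)"
      "\<And>i u. f (A1 i u) = A' i (f u)" "\<And>u i. f (R1 u i) = R' (f u) i"
    and nz: "f u0 \<noteq> 0"
  shows "yd_iso sc' A' R' sc1 A1 R1"
proof -
  have yd1: "is_YD sc1 A1 R1" and yd2: "is_YD sc' A' R'" using s1 s2 unfolding yd_simple_def by auto
  have f0: "f 0 = 0" using f(1)[of 0 0] by simp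
  have 0: "sc' c 0 = 0" "A' i 0 = 0" "R' 0 i = 0" for c i
  proof -
    have a: "A' i (u + v) = A' i u + A' i v" "R' (u + v) i = R' u i + R' v i" for u v
      using yd2 unfolding is_YD_def by (simp_all del: split_paired_All)
    interpret vector_space sc' using yd2 unfolding is_YD_def by blast
    show "sc' c 0 = 0" "A' i 0 = 0" "R' 0 i = 0" using a[of 0 0] by simp_all
  qed
  have "yd_sub sc1 A1 R1 {u. f u = 0}"
    unfolding yd_sub_def by (simp add: f f0 0 del: split_paired_All)
  then have "{u. f u = 0} = {0} \<or> {u. f u = 0} = UNIV"
    using s1 unfolding yd_simple_def by blast
  with nz have ker: "u = 0" if "f u = 0" for u using that by blast
  have inj: "inj f"
  proof (rule injI)
    fix u v assume "f u = f v"
    with f(1)[of "u - v" v] have "f (u - v) = 0" by simp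
    from ker[OF this] show "u = v" by simp
  qed
  have "yd_sub sc' A' R' (range f)"
    unfolding yd_sub_def
    by (auto simp del: split_paired_All simp: f[symmetric] intro: range_eqI[of _ f 0, OF f0[symmetric]])
  then have "range f = {0} \<or> range f = UNIV"
    using s2 unfolding yd_simple_def by blast
  with nz have "range f = UNIV" by (metis rangeI singletonD)
  then have "bij f" using inj by (simp add: bij_def)
  then have "yd_iso sc1 A1 R1 sc' A' R'" unfolding yd_iso_def using f by blast
  then show ?thesis by (rule yd_iso_sym)
qed

section \<open>Pairwise non-isomorphism of the models\<close>

lemma yd_iso_M1:
  fixes b :: "'k::field_char_0"
  assumes "yd_iso (*) (fst (M1 b g)) (snd (M1 b g)) (*) (fst (M1 b' g')) (snd (M1 b' g'))"
  shows "b = b' \<and> g = g'"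
proof -
  obtain f where f: "bij f" "\<And>c u. f (c * u) = c * f u"
    "\<And>i u. f (fst (M1 b g) i u) = fst (M1 b' g') i (f u)"
    "\<And>u i. f (snd (M1 b g) u i) = snd (M1 b' g') (f u) i"
    using assms unfolding yd_iso_def by metis
  have "f 0 = 0" using f(2)[of 0 0] by simp
  then have nz: "f 1 \<noteq> 0" using f(1) by (metis bij_pointE zero_neq_one)
  have "f b = b * f 1" using f(2)[of b 1] by simp
  then have "b = b'" using f(3)[of "(ge, True)" 1] nz by (simp add: M1_def gen_act_def ge_def)
  moreover have "g = g'" using f(4)[of 1 "(g, False)"] nz by (auto simp: M1_def hbas_def split: if_splits)
  ultimately show ?thesis by simp
qed

text \<open>Every value of a linear map from the field is a multiple of the image of 1, which cannot
  yield both basis vectors.\<close>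

lemma not_yd_iso_12:
  "\<not> yd_iso (*) A R (sc2 :: 'k::field \<Rightarrow> 'k \<times> 'k \<Rightarrow> 'k \<times> 'k) A' R'"
proof
  assume "yd_iso (*) A R (sc2 :: 'k \<Rightarrow> 'k \<times> 'k \<Rightarrow> 'k \<times> 'k) A' R'"
  then obtain f where f: "bij f" "\<And>c u. f (c * u) = sc2 c (f u :: 'k \<times> 'k)"
    unfolding yd_iso_def by metis
  have s: "f c = sc2 c (f 1)" for c using f(2)[of c 1] by simp
  obtain c d where "f c = (1, 0)" "f d = (0, 1)" using f(1) by (metis bij_pointE)
  with s[of c] s[of d] show False by (auto simp: sc2_def)
qed

lemma yd_iso_ymod:
  fixes ii :: "'k::field_char_0"
  assumes ii: "ii * ii = -1"
    and p: "p \<in> set (labels s2)" "p' \<in> set (labels s2)"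
    and iso: "yd_iso sc2 (fst (ymod ii p)) (snd (ymod ii p)) sc2 (fst (ymod ii p')) (snd (ymod ii p'))"
  shows "p = p'"
proof -
  \<comment> \<open>Ordering the three kinds as \<open>Even\<close>, \<open>OddP\<close>,
    \<open>OddM\<close>, this excludes only isomorphisms to a later kind. Applying it again to the
    inverse isomorphism excludes the others.\<close>
  have main: "p = p' \<or> (\<exists>\<alpha> \<beta> g h. p' = Even \<alpha> \<beta> g h) \<and> (\<nexists>\<alpha> \<beta> g h. p = Even \<alpha> \<beta> g h)
      \<or> (\<exists>a b. p' = OddP a b) \<and> (\<exists>a b. p = OddM a b)"
    if p: "p \<in> set (labels s2)" "p' \<in> set (labels s2)" and
      iso: "yd_iso sc2 (fst (ymod ii p)) (snd (ymod ii p)) sc2 (fst (ymod ii p')) (snd (ymod ii p'))"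
    for p p' :: "'k label"
  proof -
    obtain f where f: "bij f" "\<And>u v. f (u + v) = f u + f v" "\<And>c u. f (sc2 c u) = sc2 c (f u)"
      "\<And>i u. f (fst (ymod ii p) i u) = fst (ymod ii p') i (f u)"
      "\<And>u i. f (snd (ymod ii p) u i) = snd (ymod ii p') (f u) i"
      using iso unfolding yd_iso_def by metis
    obtain a b where v: "f (1, 0) = (a, b)" by fastforce
    have z: "f 0 = 0" using f(2)[of 0 0] by simp
    have "f (1, 0) \<noteq> 0" using f(1) z by (metis bij_pointE prod.inject zero_neq_one zero_prod_def)
    then have nz: "a \<noteq> 0 \<or> b \<noteq> 0" by (auto simp: v zero_prod_def)
    have s: "f (c, 0) = (c * a, c * b)" for c using f(3)[of c "(1,0)"] by (simp add: v sc2_def)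
    have fd: "f (u - v) = f u - f v" for u v using f(2)[of "u - v" v] by (simp add: algebra_simps)
    have J: "f (opJ (snd (ymod ii p)) u) = opJ (snd (ymod ii p')) (f u)" for u
      by (simp add: opJ_def f fd)
    have T: "f (opT (snd (ymod ii p)) u) = opT (snd (ymod ii p')) (f u)" for u
      by (simp add: opT_def f fd)
    note X = f(4)[of "(gx, False)" "(1,0)"] and Y = f(4)[of "(gy, False)" "(1,0)"]
      and XY = f(4)[of "(gxy, False)" "(1,0)"] and Z = f(4)[of "(ge, True)" "(1,0)"]
    show ?thesis
    proof (cases p)
      case P: (Even \<alpha> \<beta> g g')
      note G = f(5)[of "(1,0)" "(g, False)"]
      have gg: "g \<noteq> g'" using p by (auto simp: P labels_def)
      show ?thesis
      proof (cases p')
        case P': (Even \<alpha>' \<beta>' h h')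
        \<comment> \<open>The image of \<open>p_1\<close> keeps degree \<open>g\<close> and its
          eigenvalues, so it lies on the first or the second coordinate line. The second alternative
          would need two representatives of one orbit and contradicts \<open>labels\<close>.\<close>
        have "\<alpha> = \<alpha>' \<and> \<beta> = \<beta>' \<and> g = h \<or> \<alpha> = \<beta>' \<and> \<beta> = \<alpha>' \<and> g = h'"
          using X Y G nz unfolding P P' ymod.simps by (auto simp: even2_A even2_R gg s v split: if_splits)
        then show ?thesis using p unfolding P P' by (auto simp: labels_def)
      next
        case P': (OddP b1 b2)
        show ?thesis using G nz unfolding P P' ymod.simps by (auto simp: even2_R gg s v snd_WW odd_co_F zero_prod_def)
      next
        case P': (OddM \<sigma> t)
        show ?thesis using G nz unfolding P P' ymod.simps by (auto simp: even2_R gg s v odd2_R odd_co_F zero_prod_def)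
      qed
    next
      case P: (OddP b1 b2)
      show ?thesis
      proof (cases p')
        case P': (OddP b1' b2')
        \<comment> \<open>The eigenvalue of \<open>x\<close> keeps the image of \<open>p_1\<close>
          on the first line; there \<open>J\<close> reads off \<open>b1\<close> and \<open>z\<close>
          reads off \<open>b2\<close>.\<close>
        have "b = 0" using X unfolding P P' ymod.simps by (auto simp: WW_A s v eq_neg_iff_add_eq_0 simp flip: mult_2)
        moreover from this nz have "a \<noteq> 0" by simp
        moreover have "ii \<noteq> 0" using ii by auto
        ultimately have "b1 = b1'" "b2 = b2'"
          using J[of "(1,0)"] Z unfolding P P' ymod.simps by (simp_all add: snd_WW opJ_odd_co WW_A s v)
        then show ?thesis by (simp add: P P')
      next
        case P': (OddM \<sigma> t)
        have "\<sigma> * \<sigma> = 1" using p by (auto simp: P' labels_def)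
        then show ?thesis using XY nz unfolding P P' ymod.simps
          by (simp add: WW_A odd2_A s v eq_neg_iff_add_eq_0 flip: mult_2)
      qed (simp add: P)
    next
      case P: (OddM \<sigma> t)
      show ?thesis
      proof (cases p')
        case P': (OddM \<sigma>' t')
        have i0: "ii \<noteq> 0" using ii by auto
        then have b: "b = 0" using J[of "(1,0)"] unfolding P P' ymod.simps by (auto simp: odd2_R opJ_odd_co s v neg_eq_iff_add_eq_0 eq_neg_iff_add_eq_0 simp flip: mult_2)
        moreover from this nz have a: "a \<noteq> 0" by simp
        ultimately have 1: "\<sigma> = \<sigma>'" using X unfolding P P' ymod.simps by (simp add: odd2_A s v)
        \<comment> \<open>\<open>T\<close> sends \<open>p_1\<close> to \<open>-ii p_2\<close> in
          both modules, so \<open>f\<close> acts on both lines by the same scalar \<open>a\<close>,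
          and \<open>z p_1\<close> can be compared.\<close>
        have "f (0, - ii) = (0, - ii * a)" using T[of "(1,0)"] unfolding P P' ymod.simps
          by (simp add: odd2_R opT_odd_co s v b)
        then have "f (0, c) = (0, c * a)" for c using f(3)[of "c / - ii" "(0, - ii)"] i0 by (simp add: sc2_def)
        then have "(1 - ii) * t = (1 - ii) * t'" using Z a unfolding P P' ymod.simps by (simp add: odd2_A s v b)
        moreover have "1 - ii \<noteq> 0" using ii by auto
        ultimately show ?thesis using 1 by (simp add: P P')
      qed (simp_all add: P)
    qed
  qed
  from main[OF p iso] main[OF p(2) p(1) yd_iso_sym[OF iso]] show ?thesis by auto
qed

section \<open>Classification\<close>

lemma gen_act_simps:
  "gen_act X Y Z (ge, False) u = u" "gen_act X Y Z (gx, False) u = X u"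
  "gen_act X Y Z (gy, False) u = Y u" "gen_act X Y Z (gxy, False) u = X (Y u)"
  "gen_act X Y Z (ge, True) u = Z u" "gen_act X Y Z (gx, True) u = X (Z u)"
  "gen_act X Y Z (gy, True) u = Y (Z u)" "gen_act X Y Z (gxy, True) u = X (Y (Z u))"
  by (simp_all add: gen_act_def ge_def gx_def gy_def gxy_def)

section \<open>Tools for an arbitrary simple module\<close>

context yd_reduced begin

lemma act_0: "act i 0 = 0" and rho_0: "rho 0 i = 0"
  using act_add[of i 0 0] rho_add[of 0 0 i] by simp_all

lemma act_minus: "act i (- u) = - act i u" and rho_minus: "rho (- u) i = - rho u i"
  using act_add[of i u "- u"] rho_add[of u "- u" i] by (simp_all add: act_0 rho_0 eq_neg_iff_add_eq_0 add.commute)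

lemma act_diff: "act i (u - v) = act i u - act i v" and rho_diff: "rho (u - v) i = rho u i - rho v i"
  using act_add[of i u "- v"] rho_add[of u "- v" i] by (simp_all add: act_minus rho_minus)

lemma act_XX: "act (gx, False) (act (gx, False) u) = u"
  and act_YY: "act (gy, False) (act (gy, False) u) = u"
  and act_XY: "act (gx, False) (act (gy, False) u) = act (gxy, False) u"
  and act_YX: "act (gy, False) (act (gx, False) u) = act (gxy, False) u"
  and act_gT: "act (gx, True) u = act (gx, False) (act (ge, True) u)"
     "act (gy, True) u = act (gy, False) (act (ge, True) u)"
     "act (gxy, True) u = act (gxy, False) (act (ge, True) u)"
  and act_ZX: "act (ge, True) (act (gx, False) u) = act (gy, False) (act (ge, True) u)"
  and act_ZY: "act (ge, True) (act (gy, False) u) = act (gx, False) (act (ge, True) u)"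
  and act_ZZ: "act (ge, True) (act (ge, True) u)
    = sc (1/2) (u + act (gx, False) u + act (gy, False) u - act (gxy, False) u)"
  by (simp_all add: act_F act_TF act_TT act_one zsq_def)

lemma act_gen_act:
  "act i u = gen_act (act (gx, False)) (act (gy, False)) (act (ge, True)) i u"
proof -
  obtain g b where i: "i = (g, b)" by fastforce
  show ?thesis unfolding i using g_cases[of g]
    by (cases b; elim disjE) (simp_all add: gen_act_simps act_gT act_one act_XY)
qed

lemma gen_act_hom:
  assumes "\<And>u. f (X u) = act (gx, False) (f u)" "\<And>u. f (Y u) = act (gy, False) (f u)"
    "\<And>u. f (Z u) = act (ge, True) (f u)"
  shows "f (gen_act X Y Z i u) = act i (f u)"
  unfolding act_gen_act[of i] by (simp add: gen_act_def assms)

lemma yd_iso_sc2_I: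
  assumes simple: "yd_simple sc act rho" "yd_simple sc2 (gen_act X Y Z) R"
    and f: "\<And>u. f u = sc (fst u) v + sc (snd u) w" and v: "v \<noteq> 0"
    and XYZ: "\<And>u. f (X u) = act (gx, False) (f u)" "\<And>u. f (Y u) = act (gy, False) (f u)"
      "\<And>u. f (Z u) = act (ge, True) (f u)"
    and R: "\<And>u g b. f (R u (g, b)) = rho (f u) (g, b)"
  shows "yd_iso sc act rho sc2 (gen_act X Y Z) R"
proof (rule schur_yd_iso[OF simple(2,1), of f])
  show "f (gen_act X Y Z i u) = act i (f u)" for i u by (rule gen_act_hom[OF XYZ])
  show "f (R u i) = rho (f u) i" for u i by (cases i) (simp add: R)
  show "f (1, 0) \<noteq> 0" using v by (simp add: f)
qed (simp_all add: f sc2_def algebra_simps)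

lemma yd_iso_M1_I:
  assumes simple: "yd_simple sc act rho" "yd_simple (*) (fst (M1 b g)) (snd (M1 b g))"
    and v: "v \<noteq> 0" "rho v (g, False) = v" "act (ge, True) v = sc b v"
      "act (gx, False) v = sc (b^2) v" "act (gy, False) v = sc (b^2) v"
  shows "yd_iso sc act rho (*) (fst (M1 b g)) (snd (M1 b g))"
proof (rule schur_yd_iso[OF simple(2,1), of "\<lambda>c. sc c v"])
  fix u i
  show "sc (fst (M1 b g) i u) v = act i (sc u v)"
    unfolding M1_def fst_conv by (rule gen_act_hom) (simp_all add: act_sc v mult.commute)
  have r: "rho v (k, True) = 0" "rho v (k, False) = (if g = k then v else 0)" for k
    using rho_FT[of v g k] rho_FF[of v g k] unfolding v by simp_all
  obtain k t where i: "i = (k, t)" by fastforce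
  show "sc (snd (M1 b g) u i) v = rho (sc u v) i"
    unfolding i by (cases t) (simp_all add: M1_def hbas_def rho_sc r)
  show "sc 1 v \<noteq> 0" using v by simp
qed (simp_all add: algebra_simps)

text \<open>The common kernel \<open>?W\<close> of the odd coordinates is a subobject containing
  every even coordinate \<open>rho u (g, False)\<close>. If it is zero, all even coordinates
  vanish.\<close>

lemma even_or_odd:
  assumes "yd_simple sc act rho"
  shows "(\<forall>u g. rho u (g, True) = 0) \<or> (\<forall>u g. rho u (g, False) = 0)"
proof -
  let ?W = "{u. \<forall>g. rho u (g, True) = 0}"
  have Z: "rho (act (ge, True) u) (k, True) = 0" if "u \<in> ?W" for u k
    using that by (simp add: rho_z_T zco_T_def Let_def act_0)
  have "act i u \<in> ?W" if u: "u \<in> ?W" for i u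
  proof -
    obtain g b where i: "i = (g, b)" by fastforce
    have "act (g, True) u = act (g, False) (act (ge, True) u)" by (simp add: act_F)
    then show ?thesis using u Z[OF u] by (cases b) (simp_all add: i rho_act_T act_0)
  qed
  moreover have "rho u i \<in> ?W" if "u \<in> ?W" for i u
    using that by (cases i; cases "snd i") (auto simp: rho_FT rho_0)
  ultimately have "yd_sub sc act rho ?W"
    unfolding yd_sub_def by (simp add: rho_0 rho_add rho_sc del: split_paired_All)
  with assms have W: "?W = {0} \<or> ?W = UNIV" unfolding yd_simple_def by blast
  have "rho u (g, False) \<in> ?W" for u g by (simp add: rho_FT)
  with W show ?thesis by blast
qed

text \<open>\<open>x y\<close> is central and its odd shift \<open>(x y) (gsw (x y))\<close> is
  trivial, so its fixed space is a subobject. That space contains every \<open>u + x y u\<close>; if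
  it is zero, \<open>x y\<close> acts by -1.\<close>

lemma xy_scalar:
  assumes "yd_simple sc act rho"
  shows "(\<forall>u. act (gxy, False) u = u) \<or> (\<forall>u. act (gxy, False) u = - u)"
proof -
  let ?W = "{u. act (gxy, False) u = u}"
  have "act (gxy, False) (act i u) = act i (act (gxy, False) u)" for i u
    by (cases i; cases "snd i") (auto simp: act_F act_TF gmul_commute)
  moreover have "rho (act (gxy, False) u) i = act (gxy, False) (rho u i)" for i u
    by (cases i; cases "snd i") (auto simp: rho_act_F rho_act_T)
  ultimately have "yd_sub sc act rho ?W"
    unfolding yd_sub_def by (simp add: act_0 act_add act_sc del: split_paired_All) metis
  with assms have W: "?W = {0} \<or> ?W = UNIV" unfolding yd_simple_def by blast
  have "u + act (gxy, False) u \<in> ?W" for u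
    by (simp add: act_add act_F act_one add.commute)
  with W show ?thesis by (auto simp: eq_neg_iff_add_eq_0 add.commute)
qed

text \<open>The two candidates \<open>v + P v / r\<close> and \<open>v - P v / r\<close> add up to
  \<open>2 v\<close>, so one is nonzero. The explicit form matters: operators commuting with
  \<open>P\<close> keep their eigenvalue on the new vector.\<close>

lemma eigenvector:
  assumes v: "v \<noteq> 0" and P: "\<And>u v. P (u + v) = P u + P v" "\<And>c u. P (sc c u) = sc c (P u)"
    and PP: "P (P v) = sc (r * r) v" and r: "r \<noteq> 0"
  obtains r' where "r' = r \<or> r' = - r" "v + sc (1 / r') (P v) \<noteq> 0"
    "P (v + sc (1 / r') (P v)) = sc r' (v + sc (1 / r') (P v))"
proof -
  have nz: "v + sc (1 / r) (P v) \<noteq> 0 \<or> v + sc (1 / - r) (P v) \<noteq> 0"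
  proof (rule ccontr)
    assume "\<not> ?thesis"
    then have *: "v + sc (1 / r) (P v) = 0" "v - sc (1 / r) (P v) = 0"
      by (simp_all only: de_Morgan_disj not_not divide_minus_right scale_minus_left add_uminus_conv_diff)
    have "v + v = (v + sc (1 / r) (P v)) + (v - sc (1 / r) (P v))" by simp
    also have "\<dots> = 0" unfolding * by simp
    finally have "v + v = 0" .
    then have "sc 2 v = 0" using scale_left_distrib[of 1 1 v] by simp
    then show False using v by simp
  qed
  have "P (v + sc (1 / r') (P v)) = sc r' (v + sc (1 / r') (P v))" if "r' = r \<or> r' = - r" for r'
    using that r by (auto simp: P PP scale_right_distrib)
  with nz that show ?thesis by blast
qed

end

section \<open>Simple modules with even coaction\<close>

context yd_reduced begin

definition even_state :: "'v \<Rightarrow> 'k \<Rightarrow> 'k \<Rightarrow> bool \<times> bool \<Rightarrow> bool" where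
  "even_state v \<alpha> \<beta> g \<longleftrightarrow> v \<noteq> 0 \<and> (\<alpha> = 1 \<or> \<alpha> = -1) \<and> (\<beta> = 1 \<or> \<beta> = -1) \<and>
     act (gx, False) v = sc \<alpha> v \<and> act (gy, False) v = sc \<beta> v \<and> rho v (g, False) = v"

lemma even_state_rho:
  assumes "even_state v \<alpha> \<beta> g"
  shows "rho v (k, True) = 0" "rho v (k, False) = (if g = k then v else 0)"
proof -
  have e: "rho v (g, False) = v" using assms by (simp add: even_state_def)
  show "rho v (k, True) = 0" "rho v (k, False) = (if g = k then v else 0)"
    using rho_FT[of v g k] rho_FF[of v g k] unfolding e by simp_all
qed

text \<open>The degree of \<open>z v\<close> for an eigenvector \<open>v\<close> of degree \<open>g\<close>.\<close>

definition zdeg :: "'k \<Rightarrow> 'k \<Rightarrow> bool \<times> bool \<Rightarrow> bool \<times> bool" where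
  "zdeg \<alpha> \<beta> g = gmul (gsw g) (gmul (if \<alpha> = -1 then gx else ge) (if \<beta> = -1 then gy else ge))"

lemma even_state_Z:
  assumes st: "even_state v \<alpha> \<beta> g"
  shows "act (ge, True) (act (ge, True) v) = sc (if \<alpha> = -1 \<and> \<beta> = -1 then -1 else 1) v"
    "even_state (act (ge, True) v) \<beta> \<alpha> (zdeg \<alpha> \<beta> g)"
proof -
  have v: "v \<noteq> 0" "act (gx, False) v = sc \<alpha> v" "act (gy, False) v = sc \<beta> v" "act (gxy, False) v = sc (\<alpha> * \<beta>) v"
    and ab: "\<alpha> = 1 \<or> \<alpha> = -1" "\<beta> = 1 \<or> \<beta> = -1"
    using st by (simp_all add: even_state_def act_sc mult.commute flip: act_XY)
  let ?w = "act (ge, True) v"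
  have "sc (1/2) (v + sc \<alpha> v + sc \<beta> v - sc (\<alpha> * \<beta>) v) = sc (1/2 * (1 + \<alpha> + \<beta> - \<alpha> * \<beta>)) v"
    by (simp add: algebra_simps add_divide_distrib diff_divide_distrib)
  also have "1/2 * (1 + \<alpha> + \<beta> - \<alpha> * \<beta>) = (if \<alpha> = -1 \<and> \<beta> = -1 then -1 else 1)"
    using ab by auto
  finally show ZZ: "act (ge, True) ?w = sc (if \<alpha> = -1 \<and> \<beta> = -1 then -1 else 1) v"
    by (simp add: act_ZZ v)
  then have nz: "?w \<noteq> 0" using v(1) by (auto simp: act_0 split: if_splits)
  have w: "act (gx, False) ?w = sc \<beta> ?w" "act (gy, False) ?w = sc \<alpha> ?w" "act (gxy, False) ?w = sc (\<alpha> * \<beta>) ?w"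
    by (simp_all add: v act_sc mult.commute flip: act_XY act_ZX act_ZY)
  have quarter: "sc (1/4) (w + w + w + w) = w" for w
  proof -
    have "w + w + w + w = sc (1 + 1 + 1 + 1) w" by (simp only: scale_left_distrib scale_one)
    then show ?thesis by simp
  qed
  \<comment> \<open>\<open>v\<close> is homogeneous, so among the translates in \<open>zco_F\<close>
    only the one that carries \<open>gsw (zdeg \<alpha> \<beta> g)\<close> to \<open>g\<close>
    survives.\<close>
  have A: "act (q, True) (rho v (gmul (gsw (zdeg \<alpha> \<beta> g)) n, False)) =
     (if n = gmul (if \<alpha> = -1 then gy else ge) (if \<beta> = -1 then gx else ge) then act (q, True) v else 0)" for q n
    using g_cases[of g] g_cases[of n] ab
    unfolding even_state_rho[OF st] zdeg_def by (elim disjE; simp add: act_0)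
  have "rho ?w (zdeg \<alpha> \<beta> g, False) = ?w"
    unfolding rho_z_F zco_F_def Let_def A act_gT w using ab
    by (elim disjE; simp add: w quarter)
  with nz w ab show "even_state ?w \<beta> \<alpha> (zdeg \<alpha> \<beta> g)"
    by (auto simp: even_state_def)
qed

text \<open>Dividing \<open>z v\<close> by a root \<open>c\<close> of the eigenvalue of
  \<open>z^2\<close> makes the action symmetric: \<open>z v = c w\<close> and
  \<open>z w = c v\<close>, as in \<open>even2\<close>.\<close>

lemma even_state_iso2:
  assumes simple: "yd_simple sc act rho" and st: "even_state v \<alpha> \<beta> g"
    and N: "yd_simple sc2 (fst (even2 \<alpha> \<beta> c g (zdeg \<alpha> \<beta> g))) (snd (even2 \<alpha> \<beta> c g (zdeg \<alpha> \<beta> g)))"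
    and c: "c * c = (if \<alpha> = -1 \<and> \<beta> = -1 then -1 else 1)"
  shows "yd_iso sc act rho sc2 (fst (even2 \<alpha> \<beta> c g (zdeg \<alpha> \<beta> g))) (snd (even2 \<alpha> \<beta> c g (zdeg \<alpha> \<beta> g)))"
proof -
  define w where "w = sc (1 / c) (act (ge, True) v)"
  note Z = even_state_Z[OF st]
  have c0: "c \<noteq> 0" using c by (auto split: if_splits)
  have v: "v \<noteq> 0" "act (gx, False) v = sc \<alpha> v" "act (gy, False) v = sc \<beta> v"
    "act (gx, False) w = sc \<beta> w" "act (gy, False) w = sc \<alpha> w"
    using st Z(2) by (simp_all add: even_state_def act_sc mult.commute w_def)
  have Zv: "act (ge, True) v = sc c w" "act (ge, True) w = sc c v"
    using c0 by (simp_all add: w_def act_sc Z(1) flip: c)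
  show ?thesis
    unfolding even2_def fst_conv snd_conv
  proof (rule yd_iso_sc2_I[OF simple N[unfolded even2_def fst_conv snd_conv], where f = "\<lambda>u. sc (fst u) v + sc (snd u) w", OF refl])
    fix u :: "'k \<times> 'k" and k b
    show "v \<noteq> 0" by fact
    let ?f = "\<lambda>u. sc (fst u) v + sc (snd u) w"
    show "?f (lmap2 (sc2 \<alpha> e1) (sc2 \<beta> e2) u) = act (gx, False) (?f u)"
      "?f (lmap2 (sc2 \<beta> e1) (sc2 \<alpha> e2) u) = act (gy, False) (?f u)"
      unfolding act_add act_sc v
      by (simp_all add: lmap2_def sc2_def e1_def e2_def mult.commute)
    show "?f (lmap2 (sc2 c e2) (sc2 c e1) u) = act (ge, True) (?f u)"
      unfolding act_add act_sc Zv by (simp add: lmap2_def sc2_def e1_def e2_def mult.commute add.commute)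
    have d: "diagco g (zdeg \<alpha> \<beta> g) u (k, b) =
        (if k = g \<and> \<not> b then fst u else 0, if k = zdeg \<alpha> \<beta> g \<and> \<not> b then snd u else 0)"
      by (auto simp: diagco_def co2_def tens_def hbas_def sc2_def e1_def e2_def)
    show "?f (diagco g (zdeg \<alpha> \<beta> g) u (k, b)) = rho (?f u) (k, b)"
      unfolding d rho_add rho_sc by (cases b) (auto simp: w_def rho_sc even_state_rho[OF st] even_state_rho[OF Z(2)])
  qed
qed

lemma even_classification:
  assumes simple: "yd_simple sc act rho" and even: "\<And>u g. rho u (g, True) = 0"
    and ii: "ii * ii = -1" and s2: "s2 * s2 = 2"
  shows "(\<exists>(b, g) \<in> set (labels1 ii). yd_iso sc act rho (*) (fst (M1 b g)) (snd (M1 b g)))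
    \<or> (\<exists>p \<in> set (labels s2). yd_iso sc act rho sc2 (fst (ymod ii p)) (snd (ymod ii p)))"
proof -
  obtain v \<alpha> \<beta> g where st: "even_state v \<alpha> \<beta> g"
  proof -
    obtain u0 :: 'v where "u0 \<noteq> 0" using simple unfolding yd_simple_def by blast
    with rho_counit[of u0] have "(\<Sum>g\<in>UNIV. rho u0 (g, False)) \<noteq> 0" by (simp add: even)
    then have "\<exists>g. rho u0 (g, False) \<noteq> 0" by (metis sum.neutral)
    then obtain g where g: "rho u0 (g, False) \<noteq> 0" ..
    define v0 where "v0 = rho u0 (g, False)"
    have v0: "v0 \<noteq> 0" "rho v0 (g, False) = v0" using g by (simp_all add: v0_def rho_FF)
    obtain \<alpha> where \<alpha>: "\<alpha> = 1 \<or> \<alpha> = -1" "v0 + sc (1/\<alpha>) (act (gx, False) v0) \<noteq> 0"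
      "act (gx, False) (v0 + sc (1/\<alpha>) (act (gx, False) v0)) = sc \<alpha> (v0 + sc (1/\<alpha>) (act (gx, False) v0))"
      by (rule eigenvector[of v0 "act (gx, False)" 1]) (auto simp: v0 act_add act_sc act_XX)
    define v1 where "v1 = v0 + sc (1/\<alpha>) (act (gx, False) v0)"
    have v1: "v1 \<noteq> 0" "rho v1 (g, False) = v1" "act (gx, False) v1 = sc \<alpha> v1"
      using \<alpha> by (simp_all add: v1_def rho_add rho_sc rho_act_F v0)
    obtain \<beta> where \<beta>: "\<beta> = 1 \<or> \<beta> = -1" "v1 + sc (1/\<beta>) (act (gy, False) v1) \<noteq> 0"
      "act (gy, False) (v1 + sc (1/\<beta>) (act (gy, False) v1)) = sc \<beta> (v1 + sc (1/\<beta>) (act (gy, False) v1))"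
      by (rule eigenvector[of v1 "act (gy, False)" 1]) (auto simp: v1 act_add act_sc act_YY)
    define v2 where "v2 = v1 + sc (1/\<beta>) (act (gy, False) v1)"
    have "act (gx, False) (act (gy, False) v1) = act (gy, False) (act (gx, False) v1)"
      by (simp add: act_XY act_YX)
    then have "act (gx, False) v2 = sc \<alpha> v2"
      by (simp add: v2_def act_add act_sc v1 scale_right_distrib mult.commute)
    moreover have "rho v2 (g, False) = v2" by (simp add: v2_def rho_add rho_sc rho_act_F v1)
    ultimately have "even_state v2 \<alpha> \<beta> g" using \<alpha>(1) \<beta> by (simp add: even_state_def v2_def)
    then show ?thesis by (rule that)
  qed
  have two: ?thesis if st: "even_state v \<alpha> \<beta> g" and p: "Even \<alpha> \<beta> g (zdeg \<alpha> \<beta> g) \<in> set (labels s2)" for v \<alpha> \<beta> g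
  proof -
    define c where "c = (if \<alpha> = -1 \<and> \<beta> = -1 then ii else 1)"
    have "yd_iso sc act rho sc2 (fst (even2 \<alpha> \<beta> c g (zdeg \<alpha> \<beta> g))) (snd (even2 \<alpha> \<beta> c g (zdeg \<alpha> \<beta> g)))"
      using yd_simple_labels[OF ii s2 p] ii by (intro even_state_iso2[OF simple st]) (auto simp: c_def)
    then show ?thesis using p by (intro disjI2 bexI[of _ "Even \<alpha> \<beta> g (zdeg \<alpha> \<beta> g)"]) (simp_all add: c_def)
  qed
  \<comment> \<open>When \<open>z\<close> preserves the eigenvalues and the degree, an eigenvector
    of \<open>z\<close> inside the span of \<open>v\<close> and \<open>z v\<close> spans a
    one-dimensional model.\<close>
  have one: ?thesis if st: "even_state v \<alpha> \<alpha> g" and g: "zdeg \<alpha> \<alpha> g = g"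
    and b: "b * b = \<alpha>" "\<And>b'. b' = b \<or> b' = - b \<Longrightarrow> (b', g) \<in> set (labels1 ii)" for v \<alpha> g b
  proof -
    have \<alpha>: "\<alpha> = 1 \<or> \<alpha> = -1" and v: "v \<noteq> 0" "act (gx, False) v = sc \<alpha> v" "act (gy, False) v = sc \<alpha> v" "rho v (g, False) = v"
      using st by (simp_all add: even_state_def)
    have w: "act (gx, False) (act (ge, True) v) = sc \<alpha> (act (ge, True) v)"
      "act (gy, False) (act (ge, True) v) = sc \<alpha> (act (ge, True) v)"
      "rho (act (ge, True) v) (g, False) = act (ge, True) v"
      using even_state_Z(2)[OF st] by (simp_all add: even_state_def g)
    have ZZ: "act (ge, True) (act (ge, True) v) = sc (b * b) v"
      using even_state_Z(1)[OF st] \<alpha> by (auto simp: b)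
    have "b \<noteq> 0" using b(1) \<alpha> by auto
    then obtain b' where b': "b' = b \<or> b' = - b" "v + sc (1 / b') (act (ge, True) v) \<noteq> 0"
      "act (ge, True) (v + sc (1 / b') (act (ge, True) v)) = sc b' (v + sc (1 / b') (act (ge, True) v))"
      by (rule eigenvector[of v "act (ge, True)" b, OF v(1) act_add act_sc ZZ])
    have l: "(b', g) \<in> set (labels1 ii)" by (rule b(2)[OF b'(1)])
    have bb: "b'\<^sup>2 = \<alpha>" using b'(1) b(1) by (auto simp: power2_eq_square)
    have "yd_iso sc act rho (*) (fst (M1 b' g)) (snd (M1 b' g))"
      by (rule yd_iso_M1_I[OF simple yd_simple_1[OF is_YD_labels1[OF ii l]] b'(2) _ b'(3)])
        (simp_all add: bb act_add act_sc rho_add rho_sc v w scale_right_distrib mult.commute)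
    with l show ?thesis by blast
  qed
  have \<alpha>: "\<alpha> = 1 \<or> \<alpha> = -1" and \<beta>: "\<beta> = 1 \<or> \<beta> = -1" using st by (simp_all add: even_state_def)
  \<comment> \<open>Inspection of the 16 data: the datum or its image under \<open>z\<close> is a
    listed representative, or the datum is fixed by \<open>z\<close> and both roots of \<alpha>
    occur in \<open>labels1\<close>.\<close>
  have "Even \<alpha> \<beta> g (zdeg \<alpha> \<beta> g) \<in> set (labels s2)
     \<or> Even \<beta> \<alpha> (zdeg \<alpha> \<beta> g) (zdeg \<beta> \<alpha> (zdeg \<alpha> \<beta> g)) \<in> set (labels s2)
     \<or> \<alpha> = \<beta> \<and> zdeg \<alpha> \<beta> g = g \<and> b * b = \<alpha> \<and> (b, g) \<in> set (labels1 ii) \<and> (- b, g) \<in> set (labels1 ii)"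
    if "b = (if \<alpha> = 1 then 1 else ii)" for b
    unfolding that using \<alpha> \<beta> g_cases[of g] ii unfolding zdeg_def labels_def labels1_def
    by (elim disjE; simp)
  then show ?thesis
    using two[OF st] two[OF even_state_Z(2)[OF st]] one[of v \<alpha> g] st by blast
qed

end

section \<open>Simple modules with odd coaction\<close>

definition opS :: "('v \<Rightarrow> hidx \<Rightarrow> 'v::ab_group_add) \<Rightarrow> 'v \<Rightarrow> 'v" where
  "opS R u = R u (ge, True) + R u (gx, True) - R u (gy, True) - R u (gxy, True)"

locale yd_odd = yd_reduced sc act rho for sc :: "'k::field_char_0 \<Rightarrow> 'v::ab_group_add \<Rightarrow> 'v" and act rho +
  assumes odd: "rho u (g, False) = 0"
begin

abbreviation "T \<equiv> opT rho"
abbreviation "S \<equiv> opS rho"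
abbreviation "J \<equiv> opJ rho"

lemma sum_T: "rho u (ge, True) + rho u (gx, True) + rho u (gy, True) + rho u (gxy, True) = u"
  using rho_counit[of u] by (simp add: odd sum_g)

lemma T_lin: "T (u + v) = T u + T v" "T (sc c u) = sc c (T u)" "T (- u) = - T u"
  and S_lin: "S (u + v) = S u + S v" "S (sc c u) = sc c (S u)" "S (- u) = - S u"
  and J_lin: "J (u + v) = J u + J v" "J (sc c u) = sc c (J u)" "J (- u) = - J u"
  by (simp_all add: opT_def opS_def opJ_def rho_add rho_sc rho_minus scale_right_distrib scale_right_diff_distrib)

lemmas rho_TT' =
  rho_TT[of u ge for u, simplified] rho_TT[of u gx for u, simplified]
  rho_TT[of u gy for u, simplified] rho_TT[of u gxy for u, simplified]

lemma half: "sc (1/2) (w + w) = w"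
proof -
  have "w + w = sc (1 + 1) w" by (simp only: scale_left_distrib scale_one)
  then show ?thesis by simp
qed

text \<open>Coassociativity in coordinates makes these operators multiply like the dual of the
  matrix coalgebra; each product appears as two equal halves.\<close>

lemma TT: "T (T u) = u" and JJ: "J (J u) = - u" and JT: "J (T u) = S u" and TJ: "T (J u) = - S u"
proof -
  define w where "w = rho u (ge, True) + rho u (gx, True) + rho u (gy, True) + rho u (gxy, True)"
  have "T (T u) = sc (1/2) (w + w)" "J (J u) = - sc (1/2) (w + w)"
    by (simp_all add: w_def opT_def opJ_def rho_add rho_diff rho_TT' scale_right_distrib scale_right_diff_distrib algebra_simps)
  then show "T (T u) = u" "J (J u) = - u" by (simp_all add: half w_def sum_T)
  have "J (T u) = sc (1/2) (S u + S u)" "T (J u) = - sc (1/2) (S u + S u)"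
    by (simp_all add: opT_def opJ_def opS_def rho_add rho_diff rho_TT' scale_right_distrib scale_right_diff_distrib algebra_simps)
  then show "J (T u) = S u" "T (J u) = - S u" by (simp_all add: half)
qed

text \<open>\<open>x\<close> shifts odd coordinates by \<open>x y\<close>, and the characters
  defining \<open>T\<close> and \<open>J\<close> take the values -1 and 1 there.\<close>

lemma TX: "T (act (gx, False) u) = - act (gx, False) (T u)"
  and JX: "J (act (gx, False) u) = act (gx, False) (J u)"
  by (simp_all add: opT_def opJ_def rho_act_T act_add act_diff algebra_simps)

text \<open>Fourier inversion on the group: the coefficient at the trivial character is
  \<open>u\<close> itself, by the counit axiom.\<close>

lemma rho_T_eq:
  "rho u (g, True) = sc (1/4) (u + sc (sgx g) (T u) + sc (sgy g) (S u) + sc (sgx g * sgy g) (J u))"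
proof -
  have quarter: "sc (1/4) (w + w + w + w) = w" for w
  proof -
    have "w + w + w + w = sc (1 + 1 + 1 + 1) w" by (simp only: scale_left_distrib scale_one)
    then show ?thesis by simp
  qed
  have "u + sc (sgx g) (T u) + sc (sgy g) (S u) + sc (sgx g * sgy g) (J u)
    = rho u (g, True) + rho u (g, True) + rho u (g, True) + rho u (g, True)"
    apply (subst (1) sum_T[of u, symmetric])
    using g_cases[of g] unfolding opT_def opS_def opJ_def
    by (elim disjE; simp add: algebra_simps)
  then show ?thesis by (simp only: quarter)
qed

text \<open>Conjugation by \<open>z\<close> swaps \<open>x\<close> and \<open>y\<close>, hence the
  characters behind \<open>T\<close> and \<open>S\<close>; the scalar by which \<open>x y\<close>
  acts decides the signs.\<close>

lemma Z_plus:
  assumes "\<And>u. act (gxy, False) u = u"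
  shows "J (act (ge, True) u) = act (ge, True) (J u)" "T (act (ge, True) u) = act (ge, True) (S u)"
    "S (act (ge, True) u) = - act (ge, True) (T u)"
proof -
  have "J (act (ge, True) u) = sc (1/2) (act (ge, True) (J u) + act (ge, True) (J u))"
    "T (act (ge, True) u) = sc (1/2) (act (ge, True) (S u) + act (ge, True) (S u))"
    "S (act (ge, True) u) = - sc (1/2) (act (ge, True) (T u) + act (ge, True) (T u))"
    by (simp_all add: opT_def opS_def opJ_def rho_z_T zco_T_def Let_def act_gT assms act_add act_diff
      scale_right_distrib scale_right_diff_distrib algebra_simps)
  then show "J (act (ge, True) u) = act (ge, True) (J u)" "T (act (ge, True) u) = act (ge, True) (S u)"
    "S (act (ge, True) u) = - act (ge, True) (T u)" by (simp_all add: half)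
qed

lemma Z_minus:
  assumes "\<And>u. act (gxy, False) u = - u"
  shows "J (act (ge, True) u) = - act (ge, True) (J u)" "T (act (ge, True) u) = act (ge, True) (S u)"
    "S (act (ge, True) u) = act (ge, True) (T u)"
proof -
  have "J (act (ge, True) u) = - sc (1/2) (act (ge, True) (J u) + act (ge, True) (J u))"
    "T (act (ge, True) u) = sc (1/2) (act (ge, True) (S u) + act (ge, True) (S u))"
    "S (act (ge, True) u) = sc (1/2) (act (ge, True) (T u) + act (ge, True) (T u))"
    by (simp_all add: opT_def opS_def opJ_def rho_z_T zco_T_def Let_def act_gT assms act_add act_diff
      scale_right_distrib scale_right_diff_distrib algebra_simps)
  then show "J (act (ge, True) u) = - act (ge, True) (J u)" "T (act (ge, True) u) = act (ge, True) (S u)"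
    "S (act (ge, True) u) = act (ge, True) (T u)" by (simp_all add: half)
qed

text \<open>By \<open>rho_T_eq\<close> and \<open>S = J T\<close> the coaction is determined by
  \<open>J\<close> and \<open>T\<close>, so the comodule condition reduces to the four equations
  \<open>JT\<close>.\<close>

lemma yd_iso_odd_I:
  assumes simple: "yd_simple sc act rho" "yd_simple sc2 (gen_act X Y Z) R"
    and f: "\<And>u. f u = sc (fst u) v + sc (snd u) w" and v: "v \<noteq> 0"
    and XYZ: "\<And>u. f (X u) = act (gx, False) (f u)" "\<And>u. f (Y u) = act (gy, False) (f u)"
      "\<And>u. f (Z u) = act (ge, True) (f u)"
    and R: "R = odd_co j t (- j * t) t' (j * t')"
    and JT: "J v = sc j v" "J w = sc (- j) w" "T v = sc t w" "T w = sc t' v"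
  shows "yd_iso sc act rho sc2 (gen_act X Y Z) R"
proof (rule yd_iso_sc2_I[OF simple f v XYZ])
  fix u :: "'k \<times> 'k" and g b
  have "S v = sc (- j * t) w" "S w = sc (j * t') v"
    using TJ[of v, THEN arg_cong[where f = uminus]] TJ[of w, THEN arg_cong[where f = uminus]]
    by (simp_all add: T_lin JT mult.commute)
  then show "f (R u (g, b)) = rho (f u) (g, b)"
    by (cases b) (simp_all add: f R odd_co_F odd_co_T odd rho_T_eq T_lin S_lin J_lin JT algebra_simps
      add_divide_distrib diff_divide_distrib)
qed

definition odd_state :: "'v \<Rightarrow> 'k \<Rightarrow> 'k \<Rightarrow> bool" where
  "odd_state v \<alpha> j \<longleftrightarrow> v \<noteq> 0 \<and> act (gx, False) v = sc \<alpha> v \<and> J v = sc j v"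

text \<open>As \<open>T\<close> reverses both signs, either the eigenvalue of \<open>x\<close> or
  that of \<open>J\<close> can be normalised; the other one remains as a parameter.\<close>

lemma odd_state_T: "odd_state v \<alpha> j \<Longrightarrow> odd_state (T v) (- \<alpha>) (- j)"
proof -
  assume v: "odd_state v \<alpha> j"
  have "T v \<noteq> 0" using v TT[of v] T_lin(1)[of 0 0] by (auto simp: odd_state_def)
  moreover have "act (gx, False) (T v) = sc (- \<alpha>) (T v)"
    using v TX[of v] by (simp add: odd_state_def T_lin)
  moreover have "J (T v) = sc (- j) (T v)"
    using v JT[of v] TJ[of v] by (simp add: odd_state_def T_lin)
  ultimately show ?thesis by (simp add: odd_state_def)
qed

lemma ex_odd_state:
  assumes simple: "yd_simple sc act rho" and ii: "ii * ii = -1"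
  obtains v \<alpha> j where "odd_state v \<alpha> j" "\<alpha> = 1 \<or> \<alpha> = -1" "j = ii \<or> j = - ii"
proof -
  obtain v0 :: 'v where v0: "v0 \<noteq> 0" using simple unfolding yd_simple_def by blast
  have i0: "ii \<noteq> 0" using ii by auto
  obtain j where j: "j = ii \<or> j = - ii" "v0 + sc (1/j) (J v0) \<noteq> 0"
    "J (v0 + sc (1/j) (J v0)) = sc j (v0 + sc (1/j) (J v0))"
    by (rule eigenvector[of v0 J ii]) (auto simp: v0 J_lin JJ ii i0)
  define v1 where "v1 = v0 + sc (1/j) (J v0)"
  obtain \<alpha> where \<alpha>: "\<alpha> = 1 \<or> \<alpha> = -1" "v1 + sc (1/\<alpha>) (act (gx, False) v1) \<noteq> 0"
    "act (gx, False) (v1 + sc (1/\<alpha>) (act (gx, False) v1)) = sc \<alpha> (v1 + sc (1/\<alpha>) (act (gx, False) v1))"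
    by (rule eigenvector[of v1 "act (gx, False)" 1]) (use j in \<open>auto simp: v1_def[symmetric] act_add act_sc act_XX\<close>)
  have "J (v1 + sc (1/\<alpha>) (act (gx, False) v1)) = sc j (v1 + sc (1/\<alpha>) (act (gx, False) v1))"
    using j(3) by (simp add: J_lin JX act_sc scale_right_distrib mult.commute flip: v1_def)
  with \<alpha> have "odd_state (v1 + sc (1/\<alpha>) (act (gx, False) v1)) \<alpha> j" by (simp add: odd_state_def)
  then show ?thesis using \<alpha>(1) j(1) by (rule that)
qed

lemma odd_classification_plus:
  assumes simple: "yd_simple sc act rho" and xy: "\<And>u. act (gxy, False) u = u"
    and ii: "ii * ii = -1" and s2: "s2 * s2 = 2"
  shows "\<exists>p \<in> set (labels s2). yd_iso sc act rho sc2 (fst (ymod ii p)) (snd (ymod ii p))"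
proof -
  obtain v0 j where st: "odd_state v0 1 j" and j: "j = ii \<or> j = - ii"
    by (rule ex_odd_state[OF simple ii]) (use odd_state_T in fastforce)
  \<comment> \<open>Chosen so that \<open>j\<close> is the eigenvalue of \<open>J\<close> on the
    first basis vector of \<open>WW ii b1 b2\<close>.\<close>
  define b1 where "b1 = (if j = ii then -1 else 1 :: 'k)"
  have jb: "j = - ii * b1" and b1: "b1 = 1 \<or> b1 = -1" using j by (auto simp: b1_def)
  have YX: "act (gy, False) u = act (gx, False) u" for u
    using act_XX[of "act (gy, False) u"] by (simp add: act_XY xy)
  have v0: "v0 \<noteq> 0" "act (gx, False) v0 = v0" "J v0 = sc j v0"
    using st by (simp_all add: odd_state_def)
  have ZZ: "act (ge, True) (act (ge, True) v0) = sc (1 * 1) v0"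
    by (simp add: act_ZZ YX v0 xy half)
  obtain b2 where b2: "b2 = 1 \<or> b2 = -1" "v0 + sc (1/b2) (act (ge, True) v0) \<noteq> 0"
    "act (ge, True) (v0 + sc (1/b2) (act (ge, True) v0)) = sc b2 (v0 + sc (1/b2) (act (ge, True) v0))"
    by (rule eigenvector[of v0 "act (ge, True)" 1, OF v0(1) act_add act_sc ZZ]) auto
  define v where "v = v0 + sc (1/b2) (act (ge, True) v0)"
  have v: "v \<noteq> 0" "act (gx, False) v = v" "J v = sc j v" "act (ge, True) v = sc b2 v"
    using b2 v0 unfolding v_def
    by (simp_all add: act_add act_sc J_lin Z_plus[OF xy] scale_right_distrib mult.commute YX act_ZX[symmetric]
         act_ZY[symmetric, unfolded YX])
  have p: "OddP b1 b2 \<in> set (labels s2)" using b1 b2(1) by (auto simp: labels_def)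
  have Tv: "act (gx, False) (T v) = - T v" "J (T v) = sc (- j) (T v)"
    using odd_state_T[of v 1 j] v by (simp_all add: odd_state_def)
  \<comment> \<open>\<open>z T v = - S z v = - b2 J T v\<close>, and \<open>J\<close> acts on
    \<open>T v\<close> by \<open>- j\<close>.\<close>
  have ZT: "act (ge, True) (T v) = sc (j * b2) (T v)"
    using Z_plus(3)[OF xy, of v, THEN arg_cong[where f = uminus]] Tv(2)[unfolded JT]
    by (simp add: v S_lin mult.commute)
  have "yd_iso sc act rho sc2 (fst (WW ii b1 b2)) (snd (WW ii b1 b2))"
    unfolding WW_def fst_conv unfolding snd_WW[of ii b1 b2, unfolded WW_def]
  proof (rule yd_iso_odd_I[OF simple, where f = "\<lambda>u. sc (fst u) v + sc (snd u) (T v)"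
        and v = v and w = "T v" and j = "- ii * b1" and t = 1 and t' = 1])
    show "yd_simple sc2 (gen_act (lmap2 e1 (- e2)) (lmap2 e1 (- e2)) (lmap2 (sc2 b2 e1) (sc2 (- ii * b1 * b2) e2)))
       (odd_co (- ii * b1) 1 (ii * b1) 1 (- ii * b1))"
      using yd_simple_labels[OF ii s2 p] unfolding ymod.simps snd_WW unfolding WW_def fst_conv .
  qed (simp_all add: v Tv ZT TT act_add act_sc YX jb lmap2_def sc2_def e1_def e2_def mult_ac)
  with p show ?thesis by (intro bexI[of _ "OddP b1 b2"]) simp_all
qed

lemma odd_classification_minus:
  assumes simple: "yd_simple sc act rho" and xy: "\<And>u. act (gxy, False) u = - u"
    and ii: "ii * ii = -1" and s2: "s2 * s2 = 2" and si: "si * si = ii"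
  shows "\<exists>p \<in> set (labels s2). yd_iso sc act rho sc2 (fst (ymod ii p)) (snd (ymod ii p))"
proof -
  let ?Z = "act (ge, True)"
  obtain v0 \<alpha> where st: "odd_state v0 \<alpha> (- ii)" and \<alpha>: "\<alpha> = 1 \<or> \<alpha> = -1"
    by (rule ex_odd_state[OF simple ii]) (use odd_state_T in fastforce)
  have YX: "act (gy, False) u = - act (gx, False) u" for u
    using act_XX[of "act (gy, False) u"] by (simp add: act_XY xy act_minus)
  have ZZ: "?Z (?Z u) = u" for u
    by (simp add: act_ZZ YX xy half)
  have ii': "ii * (ii * x) = - x" for x using ii by (simp flip: mult.assoc)
  have v0: "v0 \<noteq> 0" "act (gx, False) v0 = sc \<alpha> v0" "J v0 = sc (- ii) v0"
    using st by (simp_all add: odd_state_def)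
  \<comment> \<open>The square of \<open>T z\<close> is \<open>T S = - J\<close>, which is
    \<open>ii\<close> on this eigenspace of \<open>J\<close>; hence the eigenvalues
    \<open>si\<close> and \<open>- si\<close>.\<close>
  have MM: "T (?Z (T (?Z v0))) = sc (si * si) v0"
  proof -
    have "T (?Z (T (?Z v0))) = T (S v0)" by (simp add: Z_minus[OF xy] ZZ)
    also have "\<dots> = - J v0" using TJ[of "T v0"] JT[of v0] JT[of "T v0"] TT by simp
    finally show ?thesis by (simp add: v0 si)
  qed
  have "si \<noteq> 0" using si ii by auto
  then obtain \<mu> where \<mu>: "\<mu> = si \<or> \<mu> = - si" "v0 + sc (1/\<mu>) (T (?Z v0)) \<noteq> 0"
    "T (?Z (v0 + sc (1/\<mu>) (T (?Z v0)))) = sc \<mu> (v0 + sc (1/\<mu>) (T (?Z v0)))"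
    by (rule eigenvector[of v0 "\<lambda>u. T (?Z u)" si, OF v0(1) _ _ MM, rotated 2]) (auto simp: act_add act_sc T_lin)
  define v where "v = v0 + sc (1/\<mu>) (T (?Z v0))"
  \<comment> \<open>The factor \<open>ii\<close> gives \<open>T v = - ii w\<close> and
    \<open>T w = ii v\<close>, the coefficients in \<open>Wco_eq\<close>.\<close>
  define w where "w = sc ii (T v)"
  have XM: "act (gx, False) (T (?Z v0)) = sc \<alpha> (T (?Z v0))"
  proof -
    have "act (gx, False) (?Z v0) = - sc \<alpha> (?Z v0)"
      using act_ZY[of v0] by (simp add: YX v0 act_sc act_minus)
    then show ?thesis using TX[of "?Z v0", THEN arg_cong[where f = uminus]] by (simp add: T_lin)
  qed
  have JM: "J (T (?Z v0)) = sc (- ii) (T (?Z v0))"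
    using TJ[of "?Z v0"] JT[of "?Z v0"] by (simp add: Z_minus(1)[OF xy] v0 act_sc act_minus T_lin)
  have v: "v \<noteq> 0" "act (gx, False) v = sc \<alpha> v" "J v = sc (- ii) v" "T (?Z v) = sc \<mu> v"
    using \<mu> unfolding v_def by (simp_all add: act_add act_sc J_lin XM JM v0 scale_right_distrib mult.commute)
  have Tv: "T v = sc (- ii) w" "T w = sc ii v" "J w = sc ii w" "act (gx, False) w = sc (- \<alpha>) w"
    using odd_state_T[of v \<alpha> "- ii"] v by (simp_all add: w_def ii' ii T_lin TT J_lin act_sc odd_state_def mult.commute)
  have Zv: "?Z v = sc (- (ii * \<mu>)) w"
    using arg_cong[OF v(4), where f = T] by (simp add: TT T_lin Tv mult.commute)
  have Zw: "?Z w = sc \<mu> v"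
  proof -
    have "?Z w = sc ii (S (?Z v))" by (simp add: w_def act_sc Z_minus[OF xy])
    also have "S (?Z v) = sc (- (ii * \<mu>)) v"
      using JT[of "?Z v"] by (simp add: v J_lin mult.commute)
    finally show ?thesis by (simp add: ii')
  qed
  \<comment> \<open>The solution of \<open>(1 + ii) s / 2 = \<mu>\<close>, the coefficient of
    \<open>z w = \<mu> v\<close> in the model.\<close>
  define s where "s = \<mu> * (1 - ii)"
  have \<mu>\<mu>: "\<mu> * \<mu> = ii" using \<mu>(1) si by auto
  have "s * s = (\<mu> * \<mu>) * ((1 - ii) * (1 - ii))" by (simp add: s_def)
  also have "\<dots> = 2" unfolding \<mu>\<mu> by (simp add: algebra_simps ii ii')
  finally have "s * s = s2 * s2" using s2 by simp
  then have s: "s = s2 \<or> s = - s2" by (rule square_eq_iff[THEN iffD1])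
  have l: "1/2 * (1 - ii) * s = - (ii * \<mu>)" "1/2 * (1 + ii) * s = \<mu>"
    unfolding s_def by (simp_all add: algebra_simps ii ii' add_divide_distrib diff_divide_distrib)
  \<comment> \<open>The sign is reversed because \<open>x\<close> acts on the first basis vector of
    \<open>odd2 ii \<sigma> s\<close> by \<open>- \<sigma>\<close>.\<close>
  have p: "OddM (- \<alpha>) s \<in> set (labels s2)" using \<alpha> s by (auto simp: labels_def)
  have "yd_iso sc act rho sc2 (fst (odd2 ii (- \<alpha>) s)) (snd (odd2 ii (- \<alpha>) s))"
    unfolding odd2_def fst_conv snd_conv
  proof (rule yd_iso_odd_I[OF simple yd_simple_labels[OF ii s2 p, unfolded ymod.simps odd2_def fst_conv snd_conv],
        where f = "\<lambda>u. sc (fst u) v + sc (snd u) w" and v = v and w = w and j = "- ii" and t = "- ii" and t' = ii])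
    show "v \<noteq> 0" by (rule v(1))
  qed (simp_all only: l, simp_all add: v(2,3) Tv Zv Zw act_add act_sc YX lmap2_def sc2_def e1_def e2_def mult.commute ii)
  with p show ?thesis by (intro bexI[of _ "OddM (- \<alpha>) s"]) simp_all
qed

end

section \<open>Assembly of the cases and the final count\<close>

lemma classification:
  fixes sc :: "'k::field_char_0 \<Rightarrow> 'v::ab_group_add \<Rightarrow> 'v"
  assumes simple: "yd_simple sc act rho"
    and ii: "ii * ii = -1" and s2: "s2 * s2 = 2" and si: "si * si = ii"
  shows "(\<exists>(b, g) \<in> set (labels1 ii). yd_iso sc act rho (*) (fst (M1 b g)) (snd (M1 b g)))
    \<or> (\<exists>p \<in> set (labels s2). yd_iso sc act rho sc2 (fst (ymod ii p)) (snd (ymod ii p)))"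
proof -
  have yd: "is_YD sc act rho" using simple by (simp add: yd_simple_def)
  interpret yd_ops sc act rho
    using yd unfolding is_YD_def by (intro yd_ops.intro) blast
  interpret yd_reduced sc act rho by (rule yd_reduced[OF yd])
  show ?thesis
  proof (cases "\<forall>u g. rho u (g, True) = 0")
    case True
    then show ?thesis by (intro even_classification[OF simple _ ii s2]) simp
  next
    case False
    then interpret yd_odd sc act rho
      using even_or_odd[OF simple] by unfold_locales blast
    show ?thesis
      using xy_scalar[OF simple] odd_classification_plus[OF simple _ ii s2]
        odd_classification_minus[OF simple _ ii s2 si] by blast
  qed
qed

theorem theorem3p13:
  fixes ii s2 si :: "'k::field_char_0"
    and sc :: "'k \<Rightarrow> 'v::ab_group_add \<Rightarrow> 'v"
    and act :: "hidx \<Rightarrow> 'v \<Rightarrow> 'v"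
    and rho :: "'v \<Rightarrow> hidx \<Rightarrow> 'v"
  assumes alg_closed: "\<forall>p :: 'k poly. degree p > 0 \<longrightarrow> (\<exists>x. poly p x = 0)"
    and ii: "ii^2 = -1" and s2: "s2^2 = 2" and si: "si^2 = ii"
  shows
    "(\<forall>j<8. yd_simple (*) (fst (oned ii ! j)) (snd (oned ii ! j)))
   \<and> (\<forall>j<14. yd_simple sc2 (fst (twod ii s2 si ! j)) (snd (twod ii s2 si ! j)))
   \<and> (\<forall>j<8. \<forall>k<8. j \<noteq> k \<longrightarrow>
        \<not> yd_iso (*) (fst (oned ii ! j)) (snd (oned ii ! j)) (*) (fst (oned ii ! k)) (snd (oned ii ! k)))
   \<and> (\<forall>j<14. \<forall>k<14. j \<noteq> k \<longrightarrow>
        \<not> yd_iso sc2 (fst (twod ii s2 si ! j)) (snd (twod ii s2 si ! j))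
                 sc2 (fst (twod ii s2 si ! k)) (snd (twod ii s2 si ! k)))
   \<and> (\<forall>j<8. \<forall>k<14.
        \<not> yd_iso (*) (fst (oned ii ! j)) (snd (oned ii ! j))
                 sc2 (fst (twod ii s2 si ! k)) (snd (twod ii s2 si ! k)))
   \<and> (yd_simple sc act rho \<longrightarrow>
        card {j. j < 8 \<and> yd_iso sc act rho (*) (fst (oned ii ! j)) (snd (oned ii ! j))}
      + card {j. j < 14 \<and> yd_iso sc act rho sc2 (fst (twod ii s2 si ! j)) (snd (twod ii s2 si ! j))} = 1)"
proof -
  have i: "ii * ii = -1" and s: "s2 * s2 = 2" and r: "si * si = ii"
    using ii s2 si by (simp_all add: power2_eq_square)
  have nz: "s2 \<noteq> 0" "si \<noteq> 0" using s r i by auto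
  have len: "length (labels1 ii) = 8" "length (labels s2) = 14"
    by (simp_all add: labels1_def labels_def)
  have one: "oned ii ! j = M1 (fst (labels1 ii ! j)) (snd (labels1 ii ! j))"
    and mem1: "labels1 ii ! j \<in> set (labels1 ii)" if "j < 8" for j
    using that len by (simp_all add: oned_eq case_prod_beta)
  have two: "twod ii s2 si ! j = ymod ii (labels s2 ! j)"
    and mem2: "labels s2 ! j \<in> set (labels s2)" if "j < 14" for j
    using that len by (simp_all add: twod_eq[OF r nz(2)])
  let ?one = "\<lambda>j. yd_iso sc act rho (*) (fst (oned ii ! j)) (snd (oned ii ! j))"
  let ?two = "\<lambda>j. yd_iso sc act rho sc2 (fst (twod ii s2 si ! j)) (snd (twod ii s2 si ! j))"
  have simple1: "yd_simple (*) (fst (oned ii ! j)) (snd (oned ii ! j))" if "j < 8" for j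
    using mem1[OF that] unfolding one[OF that] by (intro yd_simple_1 is_YD_labels1[OF i]) simp
  have simple2: "yd_simple sc2 (fst (twod ii s2 si ! j)) (snd (twod ii s2 si ! j))" if "j < 14" for j
    unfolding two[OF that] by (rule yd_simple_labels[OF i s mem2[OF that]])
  have iso1: "j = k" if "j < 8" "k < 8"
    "yd_iso (*) (fst (oned ii ! j)) (snd (oned ii ! j)) (*) (fst (oned ii ! k)) (snd (oned ii ! k))" for j k
    using yd_iso_M1[OF that(3)[unfolded one[OF that(1)] one[OF that(2)]]] distinct_labels1[OF i] that(1,2) len
    by (simp add: nth_eq_iff_index_eq flip: prod_eq_iff)
  have iso2: "j = k" if "j < 14" "k < 14"
    "yd_iso sc2 (fst (twod ii s2 si ! j)) (snd (twod ii s2 si ! j)) sc2 (fst (twod ii s2 si ! k)) (snd (twod ii s2 si ! k))" for j k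
    using yd_iso_ymod[OF i mem2[OF that(1)] mem2[OF that(2)] that(3)[unfolded two[OF that(1)] two[OF that(2)]]]
      distinct_labels[OF nz(1)] that(1,2) len
    by (simp add: nth_eq_iff_index_eq)
  \<comment> \<open>\<open>classification\<close> gives existence. Two isomorphisms out of the
    unknown module combine to one between models, so non-isomorphism of the models gives
    uniqueness.\<close>
  have "card {j. j < 8 \<and> ?one j} + card {j. j < 14 \<and> ?two j} = 1" if "yd_simple sc act rho"
    using classification[OF that i s r]
  proof
    assume "\<exists>(b, g) \<in> set (labels1 ii). yd_iso sc act rho (*) (fst (M1 b g)) (snd (M1 b g))"
    then obtain j where j: "j < 8" "?one j"
      using len one by (fastforce simp: in_set_conv_nth)
    have "k = j" if "k < 8" "?one k" for k
      by (rule iso1[OF j(1) that(1) yd_iso_sym_trans[OF j(2) that(2)], symmetric])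
    then have "{j. j < 8 \<and> ?one j} = {j}" using j by blast
    moreover have "{j. j < 14 \<and> ?two j} = {}"
      using yd_iso_sym_trans[OF j(2)] not_yd_iso_12 by blast
    ultimately show ?thesis by simp
  next
    assume "\<exists>p \<in> set (labels s2). yd_iso sc act rho sc2 (fst (ymod ii p)) (snd (ymod ii p))"
    then obtain j where j: "j < 14" "?two j"
      using len two by (fastforce simp: in_set_conv_nth)
    have "k = j" if "k < 14" "?two k" for k
      by (rule iso2[OF j(1) that(1) yd_iso_sym_trans[OF j(2) that(2)], symmetric])
    then have "{j. j < 14 \<and> ?two j} = {j}" using j by blast
    moreover have "{j. j < 8 \<and> ?one j} = {}"
      using yd_iso_sym_trans[OF _ j(2)] not_yd_iso_12 by blast
    ultimately show ?thesis by simp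
  qed
  then show ?thesis
    using simple1 simple2 iso1 iso2 not_yd_iso_12 by blast
qed

end
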